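(* Let $1\le q<\infty$, $w=(w_k)$ a nonincreasing sequence of positive numbers, and $1\le p\le\infty$. The following are equivalent: (i) $\ell^p$ is symmetrically block finitely represented in the unit vector basis $\{e_k\}$ of $\lambda_q(w)$; (ii) $\ell^p$ is symmetrically finitely represented in $\lambda_q(w)$; (iii) $\ell^p$ is crudely symmetrically finitely represented in $\lambda_q(w)$; (iv) $p\in[1/\beta,1/\alpha]$ (with $1/0=\infty$), where $$\alpha=-\lim_{n\to\infty}\frac1n\log_2\sup_{j\in\mathbb N}\Big(\frac{\sum_{k=1}^jw_k^q}{\sum_{k=1}^{2^nj}w_k^q}\Big)^{1/q},\qquad \beta=\lim_{n\to\infty}\frac1n\log_2\sup_{j\in\mathbb N}\Big(\frac{\sum_{k=1}^{2^nj}w_k^q}{\sum_{k=1}^jw_k^q}\Big)^{1/q}.$$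
   Context: $\lambda_q(w)$ is the Lorentz space of real sequences $a$ with $\|a\|_{\lambda_q(w)}=(\sum_{k=1}^\infty(a^*_k)^qw_k^q)^{1/q}<\infty$, $a^*$ the nonincreasing rearrangement of $(|a_k|)$. Sequences $x,y$ have the same ordered distribution if $y_{\pi(k)}=x_k$ for some permutation $\pi$ of $\mathbb N$; finite blocks $\sum_{i=1}^m\alpha_ie_{n_i}$, $\sum_{i=1}^m\beta_ie_{k_i}$ (increasing indices) have the same ordered distribution if $\beta_i=\alpha_{\pi(i)}$ for a permutation $\pi$ of $\{1,\dots,m\}$. $\|a\|_p$ is the $\ell^p$ norm on $\mathbb R^n$ (max norm if $p=\infty$). In a space $X$: $\ell^p$ is symmetrically block finitely represented in $\{e_k\}$ if for all $n,\varepsilon>0$ there are $0=m_0<\dots<m_n$ and reals $\alpha_i$ such that the blocks $u_k=\sum_{i=m_{k-1}+1}^{m_k}\alpha_ie_i$ pairwise have the same ordered distribution and $(1+\varepsilon)^{-1}\|a\|_p\le\|\sum a_ku_k\|_X\le(1+\varepsilon)\|a\|_p$ for all $a\in\mathbb R^n$; symmetrically finitely represented if for all $n,\varepsilon>0$ there are pairwise disjointly supported $x_1,\dots,x_n\in X$ pairwise with the same ordered distribution satisfying the same $(1+\varepsilon)$ estimate; crudely symmetrically finitely represented if for some $C>0$ and every $n$ such $x_k$ exist with $C^{-1}\|a\|_p\le\|\sum a_kx_k\|_X\le C\|a\|_p$. *)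

theory Defs
  imports "HOL-Analysis.Analysis"
begin

(* Sequences are indexed from 0: a :: nat => real, a 0 = a_1, w 0 = w_1, e_i = indicator of {i}. *)

(* nonincreasing rearrangement: decr_rearr a k = a^*_{k+1}
   = inf over sets F with |F| <= k of sup_{j notin F} |a_j| *)
definition decr_rearr :: "(nat \<Rightarrow> real) \<Rightarrow> nat \<Rightarrow> real" where
  "decr_rearr a k = Inf ((\<lambda>F. Sup ((\<lambda>j. \<bar>a j\<bar>) ` (UNIV - F))) ` {F. finite F \<and> card F \<le> k})"

definition lorentz_space :: "real \<Rightarrow> (nat \<Rightarrow> real) \<Rightarrow> (nat \<Rightarrow> real) set" where
  "lorentz_space q w = {a. bdd_above (range (\<lambda>j. \<bar>a j\<bar>)) \<and>
      summable (\<lambda>k. (decr_rearr a k * w k) powr q)}"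

definition lorentz_norm :: "real \<Rightarrow> (nat \<Rightarrow> real) \<Rightarrow> (nat \<Rightarrow> real) \<Rightarrow> real" where
  "lorentz_norm q w a = (\<Sum>k. (decr_rearr a k * w k) powr q) powr (1 / q)"

definition lp_norm :: "ereal \<Rightarrow> nat \<Rightarrow> (nat \<Rightarrow> real) \<Rightarrow> real" where
  "lp_norm p n a = (if p = \<infinity> then Max (insert 0 ((\<lambda>k. \<bar>a k\<bar>) ` {1..n}))
     else (\<Sum>k=1..n. \<bar>a k\<bar> powr real_of_ereal p) powr (1 / real_of_ereal p))"

definition same_ord_dist :: "(nat \<Rightarrow> real) \<Rightarrow> (nat \<Rightarrow> real) \<Rightarrow> bool" where
  "same_ord_dist x y \<longleftrightarrow> (\<exists>\<pi>. bij \<pi> \<and> (\<forall>k. y (\<pi> k) = x k))"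

(* same ordered distribution of finite blocks, given by their coefficient lists
   (coefficients listed along increasing indices) *)
definition same_ord_dist_block :: "real list \<Rightarrow> real list \<Rightarrow> bool" where
  "same_ord_dist_block xs ys \<longleftrightarrow> length xs = length ys \<and>
     (\<exists>\<pi>. \<pi> permutes {..<length xs} \<and> (\<forall>i<length xs. ys ! i = xs ! (\<pi> i)))"

definition block_vec :: "(nat \<Rightarrow> nat) \<Rightarrow> (nat \<Rightarrow> real) \<Rightarrow> nat \<Rightarrow> nat \<Rightarrow> real" where
  "block_vec m \<alpha> k = (\<lambda>i. if m (k - 1) \<le> i \<and> i < m k then \<alpha> i else 0)"

definition block_coeffs :: "(nat \<Rightarrow> nat) \<Rightarrow> (nat \<Rightarrow> real) \<Rightarrow> nat \<Rightarrow> real list" where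
  "block_coeffs m \<alpha> k = map \<alpha> [m (k - 1)..<m k]"

definition lincomb :: "nat \<Rightarrow> (nat \<Rightarrow> real) \<Rightarrow> (nat \<Rightarrow> nat \<Rightarrow> real) \<Rightarrow> nat \<Rightarrow> real" where
  "lincomb n a x = (\<lambda>i. \<Sum>k=1..n. a k * x k i)"

definition sym_block_fin_rep :: "ereal \<Rightarrow> real \<Rightarrow> (nat \<Rightarrow> real) \<Rightarrow> bool" where
  "sym_block_fin_rep p q w \<longleftrightarrow>
    (\<forall>n. \<forall>\<epsilon>>0. \<exists>m \<alpha>. m 0 = 0 \<and> (\<forall>k<n. m k < m (Suc k)) \<and>
       (\<forall>k\<in>{1..n}. \<forall>l\<in>{1..n}. same_ord_dist_block (block_coeffs m \<alpha> k) (block_coeffs m \<alpha> l)) \<and>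
       (\<forall>a. lp_norm p n a / (1 + \<epsilon>) \<le> lorentz_norm q w (lincomb n a (block_vec m \<alpha>)) \<and>
            lorentz_norm q w (lincomb n a (block_vec m \<alpha>)) \<le> (1 + \<epsilon>) * lp_norm p n a))"

definition sym_fin_rep :: "ereal \<Rightarrow> real \<Rightarrow> (nat \<Rightarrow> real) \<Rightarrow> bool" where
  "sym_fin_rep p q w \<longleftrightarrow>
    (\<forall>n. \<forall>\<epsilon>>0. \<exists>x :: nat \<Rightarrow> nat \<Rightarrow> real.
       (\<forall>k\<in>{1..n}. x k \<in> lorentz_space q w) \<and>
       (\<forall>k\<in>{1..n}. \<forall>l\<in>{1..n}. k \<noteq> l \<longrightarrow> (\<forall>i. x k i = 0 \<or> x l i = 0)) \<and>
       (\<forall>k\<in>{1..n}. \<forall>l\<in>{1..n}. same_ord_dist (x k) (x l)) \<and>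
       (\<forall>a. lp_norm p n a / (1 + \<epsilon>) \<le> lorentz_norm q w (lincomb n a x) \<and>
            lorentz_norm q w (lincomb n a x) \<le> (1 + \<epsilon>) * lp_norm p n a))"

definition crude_sym_fin_rep :: "ereal \<Rightarrow> real \<Rightarrow> (nat \<Rightarrow> real) \<Rightarrow> bool" where
  "crude_sym_fin_rep p q w \<longleftrightarrow>
    (\<exists>C>0. \<forall>n. \<exists>x :: nat \<Rightarrow> nat \<Rightarrow> real.
       (\<forall>k\<in>{1..n}. x k \<in> lorentz_space q w) \<and>
       (\<forall>k\<in>{1..n}. \<forall>l\<in>{1..n}. k \<noteq> l \<longrightarrow> (\<forall>i. x k i = 0 \<or> x l i = 0)) \<and>
       (\<forall>k\<in>{1..n}. \<forall>l\<in>{1..n}. same_ord_dist (x k) (x l)) \<and>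
       (\<forall>a. lp_norm p n a / C \<le> lorentz_norm q w (lincomb n a x) \<and>
            lorentz_norm q w (lincomb n a x) \<le> C * lp_norm p n a))"

definition wsum :: "real \<Rightarrow> (nat \<Rightarrow> real) \<Rightarrow> nat \<Rightarrow> real" where
  "wsum q w j = (\<Sum>k<j. w k powr q)"

definition lorentz_alpha :: "real \<Rightarrow> (nat \<Rightarrow> real) \<Rightarrow> real" where
  "lorentz_alpha q w = - lim (\<lambda>n. (1 / real n) * log 2
      (SUP j\<in>{1..}. (wsum q w j / wsum q w (2 ^ n * j)) powr (1 / q)))"

definition lorentz_beta :: "real \<Rightarrow> (nat \<Rightarrow> real) \<Rightarrow> real" where
  "lorentz_beta q w = lim (\<lambda>n. (1 / real n) * log 2
      (SUP j\<in>{1..}. (wsum q w (2 ^ n * j) / wsum q w j) powr (1 / q)))"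

(* p \<in> [1/beta, 1/alpha] with 1/0 = \<infinity> *)
definition in_index_interval :: "ereal \<Rightarrow> real \<Rightarrow> real \<Rightarrow> bool" where
  "in_index_interval p \<alpha> \<beta> \<longleftrightarrow>
     (if \<beta> = 0 then p = \<infinity> else ereal (1 / \<beta>) \<le> p) \<and>
     (\<alpha> = 0 \<or> p \<le> ereal (1 / \<alpha>))"

end

theory Submission
  imports Defs
begin

text \<open>Write \<open>W\<close> for the partial sums of \<open>w powr q\<close>. The sum of \<open>n\<close> disjoint copies of \<open>x\<close> has the
  rearrangement of \<open>x\<close> with every entry repeated \<open>n\<close> times, so by Abel summation the ratio of the
  \<open>q\<close>-th powers of the norms lies between the infimum and the supremum of \<open>W (n * j) / W j\<close>.
  Testing a crude representation on the vectors of ones with \<open>n = 2 ^ N\<close> gives \<open>\<alpha> \<le> 1 / p \<le> \<beta>\<close>.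

  Conversely let \<open>p\<close> be finite, \<open>\<theta> = q / p\<close> and \<open>x l = W (2 ^ l) * 2 powr (- \<theta> * l)\<close>. The index
  condition says that \<open>x\<close> neither decays nor grows geometrically, which forces the existence of
  \<open>i \<le> j\<close> such that the sum of \<open>x\<close> over \<open>i..j\<close> dwarfs both \<open>x i\<close> and \<open>x j\<close>. Take for each block the
  sequence \<open>k powr (- 1 / p)\<close>, flattened for \<open>k \<le> 2 ^ i\<close> and cut off at \<open>2 ^ j\<close>. Combinations of
  such blocks have the rearrangement of one block times the \<open>p\<close>-norm of the coefficients, up to
  errors at the two truncations, and those are controlled by \<open>x i\<close> and \<open>x j\<close>. For \<open>p = \<infinity>\<close>
  constant blocks suffice.\<close>

section \<open>The nonincreasing rearrangement\<close>

text \<open>A level set with at most \<open>k\<close> elements may itself be chosen as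
  \<open>F\<close>. A larger one contains \<open>k + 1\<close> points, and no admissible
  \<open>F\<close> covers them all. Every later fact on the rearrangement goes through this
  count.\<close>

lemma decr_rearr_le_iff:
  assumes bdd: "bdd_above (range (\<lambda>j. \<bar>a j\<bar>))"
  shows "decr_rearr a k \<le> t \<longleftrightarrow> finite {j. \<bar>a j\<bar> > t} \<and> card {j. \<bar>a j\<bar> > t} \<le> k"
proof -
  define S where "S F = Sup ((\<lambda>j. \<bar>a j\<bar>) ` (UNIV - F))" for F
  have bdd': "bdd_above ((\<lambda>j. \<bar>a j\<bar>) ` (UNIV - F))" for F
    using bdd by (rule bdd_above_mono) auto
  have up: "\<bar>a j\<bar> \<le> S F" if "j \<notin> F" for j F
    unfolding S_def using that bdd' by (intro cSUP_upper) auto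
  have nonneg: "0 \<le> S F" if "finite F" for F
  proof -
    obtain j where "j \<notin> F"
      using ex_new_if_finite[OF infinite_UNIV_nat \<open>finite F\<close>] by blast
    then show ?thesis using up[of j F] by linarith
  qed
  have decr: "decr_rearr a k = Inf (S ` {F. finite F \<and> card F \<le> k})"
    unfolding decr_rearr_def S_def ..
  show ?thesis
  proof
    assume L: "finite {j. \<bar>a j\<bar> > t} \<and> card {j. \<bar>a j\<bar> > t} \<le> k"
    define F where "F = {j. \<bar>a j\<bar> > t}"
    \<comment> \<open>\<open>Sup\<close> says nothing useful about the empty set, so the complement
      must first be seen to be nonempty.\<close>
    have "UNIV - F \<noteq> {}"
      using L infinite_UNIV_nat unfolding F_def by (metis Diff_eq_empty_iff finite_subset)
    then have "S F \<le> t"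
      unfolding S_def by (intro cSUP_least) (auto simp: F_def)
    moreover have "bdd_below (S ` {F. finite F \<and> card F \<le> k})"
      using nonneg by (intro bdd_belowI[of _ 0]) auto
    ultimately show "decr_rearr a k \<le> t"
      unfolding decr using L by (intro cINF_lower2) (auto simp: F_def)
  next
    assume le: "decr_rearr a k \<le> t"
    show "finite {j. \<bar>a j\<bar> > t} \<and> card {j. \<bar>a j\<bar> > t} \<le> k"
    proof (rule ccontr)
      assume "\<not> ?thesis"
      then have "\<exists>G. G \<subseteq> {j. \<bar>a j\<bar> > t} \<and> card G = Suc k \<and> finite G"
        by (cases "finite {j. \<bar>a j\<bar> > t}")
          (metis not_less_eq_eq obtain_subset_with_card_n, metis infinite_arbitrarily_large)
      then obtain G where G: "G \<subseteq> {j. \<bar>a j\<bar> > t}" "card G = Suc k" "finite G" by blast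
      then have ne: "G \<noteq> {}" by auto
      \<comment> \<open>A minimum over finitely many points lies strictly above \<open>t\<close>,
        which keeps the infimum over all \<open>F\<close> away from \<open>t\<close>.\<close>
      define s where "s = Min ((\<lambda>j. \<bar>a j\<bar>) ` G)"
      have "s > t" unfolding s_def using G ne by auto
      moreover have "s \<le> S F" if "finite F" "card F \<le> k" for F
      proof -
        have "\<not> G \<subseteq> F" using that G(2) card_mono[of F G] by auto
        then obtain j where j: "j \<in> G" "j \<notin> F" by blast
        then have "s \<le> \<bar>a j\<bar>" unfolding s_def using G(3) by auto
        with up[OF j(2)] show ?thesis by linarith
      qed
      then have "s \<le> decr_rearr a k"
        unfolding decr
      proof (intro cINF_greatest)
        have "{} \<in> {F :: nat set. finite F \<and> card F \<le> k}" by simp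
        then show "{F :: nat set. finite F \<and> card F \<le> k} \<noteq> {}" by blast
      qed blast
      ultimately show False using le by linarith
    qed
  qed
qed

lemma decr_rearr_nonneg:
  assumes "bdd_above (range (\<lambda>j. \<bar>a j\<bar>))"
  shows "0 \<le> decr_rearr a k"
proof (rule ccontr)
  assume "\<not> ?thesis"
  then have "{j. \<bar>a j\<bar> > decr_rearr a k} = UNIV" by (auto simp: not_le intro: less_le_trans)
  with decr_rearr_le_iff[OF assms, of k "decr_rearr a k"] show False by auto
qed

lemma decr_rearr_antimono:
  assumes "bdd_above (range (\<lambda>j. \<bar>a j\<bar>))" and "k \<le> l"
  shows "decr_rearr a l \<le> decr_rearr a k"
  using decr_rearr_le_iff[OF assms(1), of k "decr_rearr a k"]
    decr_rearr_le_iff[OF assms(1), of l "decr_rearr a k"] assms(2) by auto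

lemma bdd_above_if_eventually_zero:
  fixes a :: "nat \<Rightarrow> real"
  assumes "\<And>i. i \<ge> N \<Longrightarrow> a i = 0"
  shows "bdd_above (range (\<lambda>j. \<bar>a j\<bar>))"
proof -
  have "range (\<lambda>j. \<bar>a j\<bar>) \<subseteq> insert 0 ((\<lambda>j. \<bar>a j\<bar>) ` {..<N})"
    using assms by (force simp: not_less[symmetric])
  then show ?thesis
    by (meson bdd_above_finite finite.insertI finite_imageI finite_lessThan finite_subset)
qed

lemma decr_rearr_eq_0:
  assumes "\<And>i. i \<ge> N \<Longrightarrow> a i = 0" and "N \<le> k"
  shows "decr_rearr a k = 0"
proof -
  have bdd: "bdd_above (range (\<lambda>j. \<bar>a j\<bar>))"
    using assms(1) by (rule bdd_above_if_eventually_zero)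
  have sub: "{j. \<bar>a j\<bar> > 0} \<subseteq> {..<N}" using assms(1) by (force simp: not_less[symmetric])
  have "finite {j. \<bar>a j\<bar> > 0}" "card {j. \<bar>a j\<bar> > 0} \<le> N"
    using finite_subset[OF sub] card_mono[OF _ sub] by auto
  with decr_rearr_le_iff[OF bdd, of k 0] decr_rearr_nonneg[OF bdd, of k] assms(2) show ?thesis by auto
qed

section \<open>Level sets of disjointly supported combinations\<close>

definition disjointly_supported :: "nat \<Rightarrow> (nat \<Rightarrow> nat \<Rightarrow> real) \<Rightarrow> bool" where
  "disjointly_supported n x \<longleftrightarrow>
    (\<forall>k\<in>{1..n}. \<forall>l\<in>{1..n}. k \<noteq> l \<longrightarrow> (\<forall>i. x k i = 0 \<or> x l i = 0))"

lemma lincomb_disjoint: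
  assumes "disjointly_supported n x" and "k \<in> {1..n}" and "x k i \<noteq> 0"
  shows "lincomb n a x i = a k * x k i"
proof -
  have "lincomb n a x i = (\<Sum>l\<in>{k}. a l * x l i)"
    unfolding lincomb_def
  proof (intro sum.mono_neutral_right ballI)
    fix l assume "l \<in> {1..n} - {k}"
    then have "x l i = 0" using assms unfolding disjointly_supported_def by blast
    then show "a l * x l i = 0" by simp
  qed (use assms in auto)
  then show ?thesis by simp
qed

lemma lincomb_eq_0:
  assumes "\<And>k. k \<in> {1..n} \<Longrightarrow> x k i = 0"
  shows "lincomb n a x i = 0"
  using assms by (auto simp: lincomb_def intro!: sum.neutral)

text \<open>Only nonzero entries exceed a level \<open>t \<ge> 0\<close>, and at such an index a
  single summand survives.\<close>

lemma lincomb_level_set: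
  assumes "disjointly_supported n x" and "0 \<le> t"
  shows "{i. \<bar>lincomb n a x i\<bar> > t} = (\<Union>k\<in>{1..n}. {i. \<bar>a k * x k i\<bar> > t})"
proof (intro set_eqI iffI)
  fix i assume i: "i \<in> {i. \<bar>lincomb n a x i\<bar> > t}"
  then have "lincomb n a x i \<noteq> 0" using assms(2) by auto
  then obtain k where "k \<in> {1..n}" "x k i \<noteq> 0" using lincomb_eq_0 by meson
  with lincomb_disjoint[OF assms(1) this, of a] i
  show "i \<in> (\<Union>k\<in>{1..n}. {i. \<bar>a k * x k i\<bar> > t})" by auto
next
  fix i assume "i \<in> (\<Union>k\<in>{1..n}. {i. \<bar>a k * x k i\<bar> > t})"
  then obtain k where k: "k \<in> {1..n}" "\<bar>a k * x k i\<bar> > t" by auto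
  then have "x k i \<noteq> 0" using assms(2) by auto
  with lincomb_disjoint[OF assms(1) k(1) this, of a] k
  show "i \<in> {i. \<bar>lincomb n a x i\<bar> > t}" by auto
qed

lemma card_lincomb_level_set:
  assumes "disjointly_supported n x" and "0 \<le> t"
    and "\<And>k. k \<in> {1..n} \<Longrightarrow> finite {i. \<bar>a k * x k i\<bar> > t}"
  shows "card {i. \<bar>lincomb n a x i\<bar> > t} = (\<Sum>k=1..n. card {i. \<bar>a k * x k i\<bar> > t})"
  unfolding lincomb_level_set[OF assms(1,2)]
proof (rule card_UN_disjoint)
  have "\<not> (\<bar>a k * x k i\<bar> > t \<and> \<bar>a l * x l i\<bar> > t)"
    if "k \<in> {1..n}" "l \<in> {1..n}" "k \<noteq> l" for k l i
  proof -
    have "x k i = 0 \<or> x l i = 0" using assms(1) that unfolding disjointly_supported_def by blast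
    then show ?thesis using assms(2) by auto
  qed
  then show "\<forall>k\<in>{1..n}. \<forall>l\<in>{1..n}. k \<noteq> l \<longrightarrow>
      {i. \<bar>a k * x k i\<bar> > t} \<inter> {i. \<bar>a l * x l i\<bar> > t} = {}"
    by blast
qed (use assms(3) in auto)

lemma bdd_lincomb:
  assumes "\<And>k. k \<in> {1..n} \<Longrightarrow> bdd_above (range (\<lambda>j. \<bar>x k j\<bar>))"
  shows "bdd_above (range (\<lambda>j. \<bar>lincomb n a x j\<bar>))"
proof -
  have "\<forall>k\<in>{1..n}. \<exists>c. \<forall>j. \<bar>x k j\<bar> \<le> c"
    using assms by (auto simp: bdd_above_def)
  then obtain c where c: "\<And>k j. k \<in> {1..n} \<Longrightarrow> \<bar>x k j\<bar> \<le> c k" by metis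
  have "\<bar>lincomb n a x j\<bar> \<le> (\<Sum>k=1..n. \<bar>a k\<bar> * c k)" for j
    unfolding lincomb_def
    by (rule order_trans[OF sum_abs]) (auto simp: abs_mult intro!: sum_mono mult_left_mono c)
  then show ?thesis by (intro bdd_aboveI2)
qed

text \<open>The permutation restricts to a bijection of level sets. Finiteness is recorded
  separately because \<open>card\<close> gives 0 on infinite sets.\<close>

lemma same_ord_dist_level_set:
  assumes "same_ord_dist x y"
  shows "finite {j. \<bar>y j\<bar> > t} \<longleftrightarrow> finite {j. \<bar>x j\<bar> > t}"
    and "card {j. \<bar>y j\<bar> > t} = card {j. \<bar>x j\<bar> > (t :: real)}"
proof -
  obtain \<pi> where \<pi>: "bij \<pi>" "\<And>k. y (\<pi> k) = x k" using assms by (auto simp: same_ord_dist_def)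
  have "bij_betw \<pi> {j. \<bar>x j\<bar> > t} {j. \<bar>y j\<bar> > t}"
    unfolding bij_betw_def
  proof
    show "inj_on \<pi> {j. \<bar>x j\<bar> > t}" using \<pi>(1) by (meson bij_is_inj inj_on_subset subset_UNIV)
    show "\<pi> ` {j. \<bar>x j\<bar> > t} = {j. \<bar>y j\<bar> > t}"
    proof (intro equalityI subsetI)
      fix j assume j: "j \<in> {j. \<bar>y j\<bar> > t}"
      obtain i where "j = \<pi> i" using \<pi>(1) by (meson bij_pointE)
      with j \<pi>(2) show "j \<in> \<pi> ` {j. \<bar>x j\<bar> > t}" by auto
    qed (use \<pi>(2) in auto)
  qed
  from bij_betw_finite[OF this] bij_betw_same_card[OF this]
  show "finite {j. \<bar>y j\<bar> > t} \<longleftrightarrow> finite {j. \<bar>x j\<bar> > t}"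
    and "card {j. \<bar>y j\<bar> > t} = card {j. \<bar>x j\<bar> > t}" by auto
qed

text \<open>Level sets of the sum are \<open>n\<close> times as large as those of one copy, and
  \<open>n * c \<le> i\<close> is the same as \<open>c \<le> i div n\<close>.\<close>

lemma decr_rearr_disjoint_copies:
  assumes n: "n \<ge> 1" and dis: "disjointly_supported n x"
    and bdd: "\<And>k. k \<in> {1..n} \<Longrightarrow> bdd_above (range (\<lambda>j. \<bar>x k j\<bar>))"
    and same: "\<And>k. k \<in> {1..n} \<Longrightarrow> same_ord_dist (x 1) (x k)"
  shows "decr_rearr (lincomb n (\<lambda>_. 1) x) i = decr_rearr (x 1) (i div n)"
proof -
  let ?s = "lincomb n (\<lambda>_. 1) x"
  have bs: "bdd_above (range (\<lambda>j. \<bar>?s j\<bar>))" using bdd by (rule bdd_lincomb)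
  have b1: "bdd_above (range (\<lambda>j. \<bar>x 1 j\<bar>))" using bdd n by auto
  have "decr_rearr ?s i \<le> t \<longleftrightarrow> decr_rearr (x 1) (i div n) \<le> t" for t
  proof (cases "t < 0")
    case True
    then show ?thesis
      using decr_rearr_nonneg[OF bs, of i] decr_rearr_nonneg[OF b1, of "i div n"] by linarith
  next
    case False
    then have t: "0 \<le> t" by simp
    define X where "X = {i. \<bar>x 1 i\<bar> > t}"
    have X: "finite {i. \<bar>x k i\<bar> > t} \<longleftrightarrow> finite X" "card {i. \<bar>x k i\<bar> > t} = card X"
      if "k \<in> {1..n}" for k
      unfolding X_def using same_ord_dist_level_set[OF same[OF that], of t] by blast+
    have L: "{i. \<bar>?s i\<bar> > t} = (\<Union>k\<in>{1..n}. {i. \<bar>x k i\<bar> > t})"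
      using lincomb_level_set[OF dis t, of "\<lambda>_. 1"] by simp
    have fin: "finite {i. \<bar>?s i\<bar> > t} \<longleftrightarrow> finite X"
      unfolding L using X(1) n by auto
    have "card {i. \<bar>?s i\<bar> > t} = n * card X" if "finite X"
      using card_lincomb_level_set[OF dis t, of "\<lambda>_. 1"] that X by simp
    then show ?thesis
      unfolding decr_rearr_le_iff[OF bs] decr_rearr_le_iff[OF b1] fin X_def[symmetric]
      using n by (auto simp: less_eq_div_iff_mult_less_eq mult.commute)
  qed
  \<comment> \<open>Two reals with the same upper bounds coincide; each is inserted as the bound
    \<open>t\<close>.\<close>
  from this[of "decr_rearr ?s i"] this[of "decr_rearr (x 1) (i div n)"]
  show ?thesis by linarith
qed

section \<open>Growth rates of submultiplicative suprema\<close>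

text \<open>Fekete's lemma. The linear lower bound keeps the infimum of \<open>a n / n\<close>
  finite, and the second conclusion records that the limit is a lower bound for every term.\<close>

lemma subadditive_tendsto:
  fixes a :: "nat \<Rightarrow> real"
  assumes sub: "\<And>m n. a (m + n) \<le> a m + a n" and lower: "\<And>n. c * real n \<le> a n"
  obtains L where "(\<lambda>n. a n / real n) \<longlonglongrightarrow> L" and "\<And>n. real n * L \<le> a n"
proof -
  define L where "L = (INF n\<in>{1..}. a n / real n)"
  have bdd: "bdd_below ((\<lambda>n. a n / real n) ` {1..})"
    using lower by (intro bdd_belowI[of _ c]) (auto simp: field_simps)
  have low: "L \<le> a n / real n" if "n \<ge> 1" for n
    unfolding L_def using bdd that by (intro cINF_lower) auto
  have "0 \<le> a 0" using sub[of 0 0] by simp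
  then have L: "real n * L \<le> a n" for n
    using low[of n] by (cases "n = 0") (auto simp: field_simps)
  have iter: "a (k * m + r) \<le> real k * a m + a r" for k m r
  proof (induction k)
    case (Suc k)
    then show ?case using sub[of m "k * m + r"] by (simp add: algebra_simps)
  qed simp
  have "(\<lambda>n. a n / real n) \<longlonglongrightarrow> L"
  proof (rule order_tendstoI)
    fix u assume "u < L"
    then show "\<forall>\<^sub>F n in sequentially. u < a n / real n"
      using low by (intro eventually_sequentiallyI[of 1]) force
  next
    fix u assume "L < u"
    then have "\<exists>x\<in>(\<lambda>n. a n / real n) ` {1..}. x < u"
      unfolding L_def using bdd by (subst (asm) cInf_less_iff) auto
    then obtain m where m: "m \<ge> 1" "a m / real m < u" by auto
    \<comment> \<open>After division of \<open>n\<close> by \<open>m\<close> with remainder,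
      \<open>\<bar>a m\<bar>\<close> pays for the incomplete multiple of \<open>m\<close> and the
      sum pays for \<open>a (n mod m)\<close>.\<close>
    define D where "D = \<bar>a m\<bar> + (\<Sum>r<m. \<bar>a r\<bar>)"
    have "a n \<le> real n * (a m / real m) + D" for n
    proof -
      have "real n = real (n div m) * real m + real (n mod m)"
        by (metis div_mult_mod_eq of_nat_add of_nat_mult)
      then have "real (n div m) * a m = real n * (a m / real m) - (real (n mod m) / real m) * a m"
        using m(1) by (simp add: field_simps)
      moreover have "- ((real (n mod m) / real m) * a m) \<le> 1 * \<bar>a m\<bar>"
      proof -
        have "real (n mod m) / real m \<le> 1" using m(1) by (simp add: divide_le_eq_1)
        then have "(real (n mod m) / real m) * \<bar>a m\<bar> \<le> 1 * \<bar>a m\<bar>"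
          by (intro mult_right_mono) auto
        moreover have "- ((real (n mod m) / real m) * a m) \<le> (real (n mod m) / real m) * \<bar>a m\<bar>"
          by (metis abs_ge_minus_self minus_mult_right mult_left_mono of_nat_0_le_iff
              zero_le_divide_iff)
        ultimately show ?thesis by (rule order_trans[rotated])
      qed
      moreover have "a (n mod m) \<le> (\<Sum>r<m. \<bar>a r\<bar>)"
        using m(1) member_le_sum[of "n mod m" "{..<m}" "\<lambda>r. \<bar>a r\<bar>"] by fastforce
      ultimately show ?thesis
        using iter[of "n div m" m "n mod m"] unfolding D_def by simp
    qed
    then have bound: "a n / real n \<le> a m / real m + D / real n" if "n \<ge> 1" for n
      using that by (simp add: field_simps)
    have "(\<lambda>n. a m / real m + D / real n) \<longlonglongrightarrow> a m / real m + 0"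
      by (intro tendsto_intros lim_const_over_n)
    then have "\<forall>\<^sub>F n in sequentially. a m / real m + D / real n < u"
      using m(2) by (intro order_tendstoD(2)) auto
    then show "\<forall>\<^sub>F n in sequentially. a n / real n < u"
      using eventually_ge_at_top[of 1] by eventually_elim (use bound in force)
  qed
  with L show thesis by (rule that[rotated])
qed

text \<open>The cocycle identity makes the suprema submultiplicative, so Fekete's lemma applies to
  their logarithms. The limit being a lower bound, each supremum is at least
  \<open>2 powr (n * lim r)\<close>; the factor \<open>c < 1\<close> leaves room for a supremum that
  is not attained. Both indices are instances.\<close>

lemma cocycle_growth_rate:
  fixes g :: "nat \<Rightarrow> nat \<Rightarrow> real"
  assumes d: "d > 0" and lower: "\<And>n j. j \<ge> 1 \<Longrightarrow> d ^ n \<le> g n j"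
    and upper: "\<And>n j. j \<ge> 1 \<Longrightarrow> g n j \<le> D n"
    and cocycle: "\<And>m n j. j \<ge> 1 \<Longrightarrow> g (m + n) j = g m (2 ^ n * j) * g n j"
  defines "r \<equiv> \<lambda>n. (1 / real n) * log 2 (SUP j\<in>{1..}. g n j)"
  shows "r \<longlonglongrightarrow> lim r"
    and "j \<ge> 1 \<Longrightarrow> g n j \<le> (SUP j\<in>{1..}. g n j)"
    and "\<And>c. 0 < c \<Longrightarrow> c < 1 \<Longrightarrow> \<exists>j\<ge>1. c * 2 powr (real n * lim r) \<le> g n j"
proof -
  define M where "M n = (SUP j\<in>{1..}. g n j)" for n
  have bdd: "bdd_above (g n ` {1..})" for n
    using upper by (intro bdd_aboveI2) auto
  have gM: "g n j \<le> M n" if "j \<ge> 1" for n j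
    unfolding M_def using bdd that by (intro cSUP_upper) auto
  have dM: "d ^ n \<le> M n" for n
    using lower[of 1 n] gM[of 1 n] by simp
  have M_pos: "M n > 0" for n
    using d dM[of n] by (meson less_le_trans zero_less_power)
  have gpos: "g n j > 0" if "j \<ge> 1" for n j
    using d lower[of j n] that by (meson less_le_trans zero_less_power)
  have sub0: "M (m + n) \<le> M m * M n" for m n
    unfolding M_def[of "m + n"]
  proof (rule cSUP_least)
    fix j :: nat assume "j \<in> {1..}"
    then have j: "j \<ge> 1" by simp
    have "g m (2 ^ n * j) * g n j \<le> M m * M n"
      using j gM[of "2 ^ n * j" m] gM[OF j, of n] gpos[OF j, of n] M_pos[of m]
      by (intro mult_mono) auto
    then show "g (m + n) j \<le> M m * M n" using cocycle[OF j] by simp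
  qed simp
  have sub: "log 2 (M (m + n)) \<le> log 2 (M m) + log 2 (M n)" for m n
  proof -
    have "log 2 (M (m + n)) \<le> log 2 (M m * M n)"
      using sub0[of m n] M_pos[of "m + n"] by simp
    also have "\<dots> = log 2 (M m) + log 2 (M n)"
      using M_pos[of m] M_pos[of n] by (simp add: log_mult)
    finally show ?thesis .
  qed
  have low: "log 2 d * real n \<le> log 2 (M n)" for n
    using dM[of n] d M_pos[of n] log_nat_power[OF less_imp_le[OF d], of 2 n]
    by (metis log_le_cancel_iff mult.commute one_less_numeral_iff semiring_norm(76) zero_less_power)
  obtain L where L: "(\<lambda>n. log 2 (M n) / real n) \<longlonglongrightarrow> L" "\<And>n. real n * L \<le> log 2 (M n)"
    using subadditive_tendsto[OF sub low] by blast
  have r: "r \<longlonglongrightarrow> L" using L(1) by (simp add: r_def M_def)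
  then have lim: "lim r = L" by (rule limI)
  with r show "r \<longlonglongrightarrow> lim r" by simp
  have pow: "2 powr (real n * lim r) \<le> M n" for n
    using L(2)[of n] M_pos[of n] unfolding lim by (simp add: le_log_iff)
  show "j \<ge> 1 \<Longrightarrow> g n j \<le> (SUP j\<in>{1..}. g n j)" using gM by (simp add: M_def)
  fix c :: real assume c: "0 < c" "c < 1"
  have "c * 2 powr (real n * lim r) < 1 * 2 powr (real n * lim r)"
    using c by (intro mult_strict_right_mono) auto
  then have "c * 2 powr (real n * lim r) < M n" using pow[of n] by linarith
  then have "\<exists>j\<in>{1..}. c * 2 powr (real n * lim r) < g n j"
    unfolding M_def using bdd by (subst (asm) less_cSUP_iff) auto
  then show "\<exists>j\<ge>1. c * 2 powr (real n * lim r) \<le> g n j" by force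
qed

text \<open>The constant contributes only \<open>log 2 c / n\<close>, which tends to 0.\<close>

lemma le_rate_if_le_power:
  assumes r: "(\<lambda>n. (1 / real n) * log 2 (M n)) \<longlonglongrightarrow> r" and "c > 0" "\<And>n. M n > 0"
    and le: "\<And>n. 2 powr (real n * t) \<le> c * M n"
  shows "t \<le> r"
proof -
  have "t \<le> log 2 c / real n + (1 / real n) * log 2 (M n)" if "n \<ge> 1" for n
  proof -
    have "real n * t \<le> log 2 (c * M n)"
      using le[of n] assms(2) assms(3)[of n] by (simp add: le_log_iff)
    also have "\<dots> = log 2 c + log 2 (M n)"
      using assms(2) assms(3)[of n] by (simp add: log_mult)
    finally show ?thesis using that by (simp add: field_simps)
  qed
  moreover have "(\<lambda>n. log 2 c / real n + (1 / real n) * log 2 (M n)) \<longlonglongrightarrow> 0 + r"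
    using r by (intro tendsto_add lim_const_over_n)
  ultimately have "t \<le> 0 + r" by (intro LIMSEQ_le_const) auto
  then show ?thesis by simp
qed

text \<open>If every sum is dominated by its end terms, then the sequence decays geometrically throughout
  or grows geometrically from some index on.\<close>

lemma interval_sum_dominates_ends:
  fixes x :: "nat \<Rightarrow> real"
  assumes pos: "\<And>i. x i > 0" and D: "D \<ge> 1" and step: "\<And>i. x i \<le> D * x (Suc i)"
    and up: "\<And>N. \<exists>i. x i \<le> c * x (i + N)" and down: "\<And>N. \<exists>i. x (i + N) \<le> c * x i"
    and c: "c > 0"
  shows "\<exists>i j. i \<le> j \<and> K * x i \<le> (\<Sum>l=i..j. x l) \<and> K * x j \<le> (\<Sum>l=i..j. x l)"
proof (rule ccontr)
  assume neg: "\<not> ?thesis"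
  \<comment> \<open>A constant of at least 2 keeps the contraction factor \<open>\<rho>\<close>
    strictly between 0 and 1.\<close>
  define k where "k = max K 2"
  define \<rho> where "\<rho> = 1 - 1 / k"
  have k: "k \<ge> 2" "k \<ge> K" unfolding k_def by auto
  have \<rho>: "0 < \<rho>" "\<rho> < 1" unfolding \<rho>_def using k(1) by (auto simp: field_simps)
  have dich: "(\<Sum>l=i..j. x l) < k * x i \<or> (\<Sum>l=i..j. x l) < k * x j" if "i \<le> j" for i j
  proof -
    have "K * x i \<le> k * x i" "K * x j \<le> k * x j"
      using pos[of i] pos[of j] k(2) by (auto intro!: mult_right_mono)
    then show ?thesis using neg that by (meson le_less_trans not_le less_le_trans)
  qed
  have small: "\<exists>N\<ge>N0. E * \<rho> ^ N < 1" for E :: real and N0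
  proof -
    have "(\<lambda>N. E * \<rho> ^ N) \<longlonglongrightarrow> E * 0"
      using \<rho> by (intro tendsto_intros LIMSEQ_power_zero) auto
    then have "\<forall>\<^sub>F N in sequentially. E * \<rho> ^ N < 1"
      by (intro order_tendstoD(2)) auto
    then show ?thesis unfolding eventually_sequentially by (meson nat_le_linear order_refl)
  qed
  show False
  \<comment> \<open>If the left end dominates on every interval, tails shrink by the factor
    \<open>\<rho>\<close> at each step, against \<open>up\<close>. Otherwise some interval escapes
    its left end, and the right end must dominate from there on.\<close>
  proof (cases "\<forall>i j. i \<le> j \<longrightarrow> (\<Sum>l=i..j. x l) \<le> k * x i")
    case True
    have geo: "(\<Sum>l=i+N..J. x l) \<le> \<rho> ^ N * (\<Sum>l=i..J. x l)" if "i + N \<le> J" for i N J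
      using that
    proof (induction N)
      case (Suc N)
      have split: "(\<Sum>l=i+N..J. x l) = x (i + N) + (\<Sum>l=i+Suc N..J. x l)"
        using Suc.prems by (simp add: sum.atLeast_Suc_atMost)
      have "(\<Sum>l=i+N..J. x l) \<le> k * x (i + N)" using True Suc.prems by auto
      then have "(\<Sum>l=i+Suc N..J. x l) \<le> \<rho> * (\<Sum>l=i+N..J. x l)"
        unfolding \<rho>_def using split k(1) by (simp add: field_simps)
      also have "\<dots> \<le> \<rho> * (\<rho> ^ N * (\<Sum>l=i..J. x l))"
        using Suc \<rho> by (intro mult_left_mono) auto
      finally show ?case by simp
    qed simp
    obtain N where N: "(c * k) * \<rho> ^ N < 1" using small by blast
    obtain i where i: "x i \<le> c * x (i + N)" using up by blast
    have "x (i + N) \<le> \<rho> ^ N * (\<Sum>l=i..i+N. x l)" using geo[of i N "i + N"] by simp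
    also have "\<dots> \<le> \<rho> ^ N * (k * x i)" using True \<rho> by (intro mult_left_mono) auto
    finally have "c * x (i + N) \<le> c * (\<rho> ^ N * (k * x i))" using c by simp
    with i have "x i \<le> ((c * k) * \<rho> ^ N) * x i" by (simp add: ac_simps)
    then show False using N pos[of i] by simp
  next
    case False
    then obtain i0 j0 where ij: "i0 \<le> j0" "k * x i0 < (\<Sum>l=i0..j0. x l)" by (force simp: not_le)
    define S where "S j = (\<Sum>l=i0..j. x l)" for j
    \<comment> \<open>Sums starting at \<open>i0\<close> increase with \<open>j\<close> while
      \<open>x i0\<close> stays fixed, so the left alternative of \<open>dich\<close> remains
      excluded.\<close>
    have S_less: "S j < k * x j" if "j \<ge> j0" for j
    proof -
      have "S j0 \<le> S j"
        unfolding S_def using that pos by (intro sum_mono2) (auto intro: less_imp_le)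
      then show ?thesis using dich[of i0 j] ij that unfolding S_def by linarith
    qed
    have geo: "S j \<le> \<rho> ^ N * S (j + N)" if "j \<ge> j0" for j N
    proof (induction N)
      case (Suc N)
      have "S (j + Suc N) = S (j + N) + x (j + Suc N)"
        unfolding S_def using that ij(1) by simp
      then have "S (j + N) \<le> \<rho> * S (j + Suc N)"
        unfolding \<rho>_def using S_less[of "j + Suc N"] that k(1) by (simp add: field_simps)
      then have "\<rho> ^ N * S (j + N) \<le> \<rho> ^ N * (\<rho> * S (j + Suc N))"
        using \<rho> by (intro mult_left_mono) auto
      with Suc show ?case by (simp add: ac_simps)
    qed simp
    have growth: "x j \<le> k * \<rho> ^ N * x (j + N)" if "j \<ge> j0" for j N
    proof -
      have "x j \<le> S j" unfolding S_def using that ij pos by (intro member_le_sum) (auto intro: less_imp_le)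
      also have "\<dots> \<le> \<rho> ^ N * S (j + N)" using geo that .
      also have "\<dots> \<le> \<rho> ^ N * (k * x (j + N))"
        using S_less[of "j + N"] that \<rho> by (intro mult_left_mono) auto
      finally show ?thesis by (simp add: ac_simps)
    qed
    have steps: "x i \<le> D ^ m * x (i + m)" for i m
    proof (induction m)
      case (Suc m)
      have "D ^ m * x (i + m) \<le> D ^ m * (D * x (i + Suc m))"
        using D step[of "i + m"] by (intro mult_left_mono) auto
      with Suc show ?case by (simp add: ac_simps)
    qed simp
    \<comment> \<open>The index returned by \<open>down\<close> may lie below \<open>j0\<close>.
      Shifting it by \<open>j0\<close> costs the factor \<open>D ^ j0\<close>, which is known before
      \<open>N\<close> is chosen.\<close>
    obtain N where N: "N \<ge> 0" "(c * D ^ j0 * k) * \<rho> ^ N < 1" using small by blast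
    obtain i where i: "x (i + (j0 + N)) \<le> c * x i" using down by blast
    text \<open>Moving from \<open>i\<close> up to \<open>i + j0\<close> puts us in the range of geometric growth.\<close>
    have "x i \<le> D ^ j0 * x (i + j0)" by (rule steps)
    also have "\<dots> \<le> D ^ j0 * (k * \<rho> ^ N * x (i + j0 + N))"
      using growth[of "i + j0" N] D by (intro mult_left_mono) auto
    also have "\<dots> \<le> D ^ j0 * (k * \<rho> ^ N * (c * x i))"
      using i k \<rho> D by (intro mult_left_mono) (auto simp: ac_simps)
    finally have "x i \<le> ((c * D ^ j0 * k) * \<rho> ^ N) * x i" by (simp add: ac_simps)
    then show False using N pos[of i] by simp
  qed
qed

section \<open>Lorentz norms and dilation indices\<close>

text \<open>Summation by parts in the form of an induction: the boundary term
  \<open>f J * G J\<close> is a lower bound for the sum.\<close>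

lemma abel_sum_nonneg:
  fixes f G :: "nat \<Rightarrow> real"
  assumes f: "\<And>j. 0 \<le> f j" "\<And>j. f (Suc j) \<le> f j" and G: "\<And>j. 0 \<le> G j" "G 0 = 0"
  shows "0 \<le> (\<Sum>j<J. f j * (G (Suc j) - G j))"
proof -
  have "f J * G J \<le> (\<Sum>j<J. f j * (G (Suc j) - G j))"
  proof (induction J)
    case (Suc J)
    have "f (Suc J) * G (Suc J) \<le> f J * G (Suc J)"
      using f G by (intro mult_right_mono) auto
    with Suc show ?case by (simp add: algebra_simps)
  qed (use G in simp)
  moreover have "0 \<le> f J * G J" using f G by simp
  ultimately show ?thesis by linarith
qed

definition inv_exponent :: "ereal \<Rightarrow> real" where
  "inv_exponent p = (if p = \<infinity> then 0 else 1 / real_of_ereal p)"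

text \<open>Passing to reciprocals, with \<open>1 / \<infinity> = 0\<close>, absorbs the special
  cases for vanishing indices.\<close>

lemma in_index_interval_iff:
  assumes "1 \<le> p" "0 \<le> \<alpha>" "0 \<le> \<beta>"
  shows "in_index_interval p \<alpha> \<beta> \<longleftrightarrow> \<alpha> \<le> inv_exponent p \<and> inv_exponent p \<le> \<beta>"
proof (cases p)
  case (real r)
  then have "r \<ge> 1" using assms(1) by simp
  have "(\<alpha> = 0 \<or> r \<le> 1 / \<alpha>) \<longleftrightarrow> \<alpha> \<le> 1 / r" "\<beta> \<noteq> 0 \<and> 1 / \<beta> \<le> r \<longleftrightarrow> 1 / r \<le> \<beta>"
    using assms(2,3) \<open>r \<ge> 1\<close> by (cases "\<alpha> = 0"; cases "\<beta> = 0"; simp add: field_simps)+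
  then show ?thesis
    using real by (auto simp: in_index_interval_def inv_exponent_def)
next
  case PInf
  then show ?thesis using assms(2,3) by (auto simp: in_index_interval_def inv_exponent_def)
qed (use assms(1) in auto)

lemma lp_norm_ones:
  assumes "n \<ge> 1"
  shows "lp_norm p n (\<lambda>_. 1) = real n powr inv_exponent p"
proof (cases "p = \<infinity>")
  case True
  have "(\<lambda>k. \<bar>1::real\<bar>) ` {1..n} = {1}" using assms by auto
  then show ?thesis using True assms by (simp add: lp_norm_def inv_exponent_def)
qed (use assms in \<open>simp add: lp_norm_def inv_exponent_def\<close>)

lemma lp_norm_unit:
  assumes "n \<ge> 1"
  shows "lp_norm p n (\<lambda>k. if k = 1 then 1 else 0) = 1"
proof (cases "p = \<infinity>")
  case True
  have "insert 0 ((\<lambda>k. \<bar>if k = 1 then 1 else 0 :: real\<bar>) ` {1..n}) = {0, 1}"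
    using assms by auto
  then show ?thesis using True by (simp add: lp_norm_def)
next
  case False
  have "(\<Sum>k=1..n. \<bar>if k = 1 then 1 else 0\<bar> powr real_of_ereal p)
      = (\<Sum>k=1..n. if k = 1 then 1 else 0 :: real)"
    by (intro sum.cong) auto
  also have "\<dots> = 1" using assms by simp
  finally show ?thesis using False by (simp add: lp_norm_def)
qed

lemma lp_norm_scale:
  assumes "c \<ge> 0" "1 \<le> p"
  shows "lp_norm p n (\<lambda>k. c * a k) = c * lp_norm p n a"
proof (cases "p = \<infinity>")
  case True
  have "insert 0 ((\<lambda>k. \<bar>c * a k\<bar>) ` {1..n}) = (*) c ` insert 0 ((\<lambda>k. \<bar>a k\<bar>) ` {1..n})"
    using assms(1) by (simp add: image_image abs_mult)
  also have "Max \<dots> = c * Max (insert 0 ((\<lambda>k. \<bar>a k\<bar>) ` {1..n}))"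
    using assms(1) by (intro mono_Max_commute[symmetric]) (auto intro!: monoI mult_left_mono)
  finally show ?thesis using True by (simp add: lp_norm_def)
next
  case False
  with assms(2) have p: "real_of_ereal p > 0" by (cases p) auto
  have "(\<Sum>k=1..n. \<bar>c * a k\<bar> powr real_of_ereal p)
      = c powr real_of_ereal p * (\<Sum>k=1..n. \<bar>a k\<bar> powr real_of_ereal p)"
    using assms(1) by (simp add: abs_mult powr_mult sum_distrib_left)
  then show ?thesis
    using False p assms(1) by (simp add: lp_norm_def powr_mult powr_powr sum_nonneg)
qed

lemma lp_norm_nonneg: "lp_norm p n a \<ge> 0"
  by (auto simp: lp_norm_def)

locale lorentz_weight =
  fixes q :: real and w :: "nat \<Rightarrow> real"
  assumes q: "1 \<le> q" and w_pos: "w k > 0" and w_Suc_le: "w (Suc k) \<le> w k"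
begin

abbreviation "v \<equiv> \<lambda>k. w k powr q"
abbreviation "W \<equiv> wsum q w"

text \<open>The \<open>q\<close>-th power of the Lorentz norm of a bounded sequence; it is linear in
  the weights and free of the outer root.\<close>

definition energy :: "(nat \<Rightarrow> real) \<Rightarrow> real" where
  "energy a = (\<Sum>k. decr_rearr a k powr q * v k)"

lemma summand_eq:
  assumes "bdd_above (range (\<lambda>j. \<bar>a j\<bar>))"
  shows "(decr_rearr a k * w k) powr q = decr_rearr a k powr q * v k"
  using decr_rearr_nonneg[OF assms] w_pos[of k] by (simp add: powr_mult)

lemma lorentz_norm_eq:
  assumes "bdd_above (range (\<lambda>j. \<bar>a j\<bar>))"
  shows "lorentz_norm q w a = energy a powr (1 / q)"
  unfolding lorentz_norm_def energy_def summand_eq[OF assms] ..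

lemma v_pos: "v k > 0"
  using w_pos[of k] by simp

lemma v_antimono: "k \<le> l \<Longrightarrow> v l \<le> v k"
proof (induction l rule: dec_induct)
  case (step l)
  have "v (Suc l) \<le> v l"
    using w_Suc_le[of l] w_pos[of "Suc l"] q by (intro powr_mono2) auto
  with step show ?case by simp
qed simp

lemma W_0 [simp]: "W 0 = 0" and W_Suc [simp]: "W (Suc j) = W j + v j"
  by (simp_all add: wsum_def)

lemma W_mono: "j \<le> l \<Longrightarrow> W j \<le> W l"
  unfolding wsum_def by (intro sum_mono2) auto

lemma W_pos: "j \<ge> 1 \<Longrightarrow> W j > 0"
proof -
  assume "j \<ge> 1"
  then have "v 0 \<le> W j" using W_mono[of 1 j] by simp
  with v_pos[of 0] show ?thesis by (rule less_le_trans)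
qed

lemma W_nonneg: "W j \<ge> 0"
  unfolding wsum_def by (intro sum_nonneg) auto

lemma W_diff: "j \<le> l \<Longrightarrow> sum v {j..<l} = W l - W j"
  unfolding wsum_def using sum_diff_nat_ivl[of 0 j l v] by (simp add: atLeast0LessThan)

text \<open>The weights are nonincreasing, so \<open>l\<close> consecutive terms further out weigh
  no more than the first \<open>l\<close>.\<close>

lemma W_add_le: "W (j + l) \<le> W j + W l"
proof (induction l)
  case (Suc l)
  then show ?case using v_antimono[of l "j + l"] by simp
qed simp

lemma W_mult_le: "W (n * j) \<le> real n * W j"
proof (induction n)
  case (Suc n)
  then show ?case using W_add_le[of j "n * j"] by (simp add: algebra_simps)
qed simp

text \<open>Grouping the indices into runs of length \<open>n\<close> replaces the weights
  \<open>v j\<close> by the increments of \<open>W (n * j)\<close>. Abel summation then transfers a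
  comparison of \<open>W j\<close> with \<open>W (n * j)\<close> to the energies.\<close>

lemma energy_copies:
  assumes n: "n \<ge> 1" and dis: "disjointly_supported n x"
    and mem: "\<And>k. k \<in> {1..n} \<Longrightarrow> x k \<in> lorentz_space q w"
    and same: "\<And>k. k \<in> {1..n} \<Longrightarrow> same_ord_dist (x 1) (x k)"
  shows "(\<And>j. W (n * j) \<le> M * W j) \<Longrightarrow> energy (lincomb n (\<lambda>_. 1) x) \<le> M * energy (x 1)"
    and "(\<And>j. W j \<le> m * W (n * j)) \<Longrightarrow> 0 \<le> m \<Longrightarrow> energy (x 1) \<le> m * energy (lincomb n (\<lambda>_. 1) x)"
    and "0 \<le> energy (x 1)" and "0 \<le> energy (lincomb n (\<lambda>_. 1) x)"
proof -
  have bdd: "bdd_above (range (\<lambda>j. \<bar>x k j\<bar>))" if "k \<in> {1..n}" for k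
    using mem[OF that] by (simp add: lorentz_space_def)
  have b1: "bdd_above (range (\<lambda>j. \<bar>x 1 j\<bar>))" using bdd n by auto
  define f where "f j = decr_rearr (x 1) j powr q" for j
  have f: "0 \<le> f j" "f (Suc j) \<le> f j" for j
    unfolding f_def using decr_rearr_nonneg[OF b1] decr_rearr_antimono[OF b1, of j "Suc j"] q
    by (auto intro!: powr_mono2)
  have E: "energy (lincomb n (\<lambda>_. 1) x) = (\<Sum>i. f (i div n) * v i)"
    by (simp only: energy_def f_def decr_rearr_disjoint_copies[OF n dis bdd same])
  have E1: "energy (x 1) = (\<Sum>j. f j * v j)" unfolding energy_def f_def ..
  have s1: "summable (\<lambda>j. f j * v j)"
  proof -
    have "summable (\<lambda>j. (decr_rearr (x 1) j * w j) powr q)"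
      using mem[of 1] n unfolding lorentz_space_def by auto
    then show ?thesis unfolding summand_eq[OF b1] f_def .
  qed
  have group: "(\<Sum>i<J * n. f (i div n) * v i) = (\<Sum>j<J. f j * (W (n * Suc j) - W (n * j)))" for J
  proof -
    have "(\<Sum>i=j*n..<j*n+n. f (i div n) * v i) = f j * (W (n * Suc j) - W (n * j))" for j
    proof -
      have "(\<Sum>i=j*n..<j*n+n. f (i div n) * v i) = (\<Sum>i=j*n..<j*n+n. f j * v i)"
      proof (intro sum.cong refl)
        fix i assume "i \<in> {j*n..<j*n+n}"
        then have "i div n = j" by (intro div_nat_eqI) (auto simp: mult.commute)
        then show "f (i div n) * v i = f j * v i" by simp
      qed
      then show ?thesis
        by (simp add: sum_distrib_left[symmetric] W_diff mult.commute[of n] add.commute[of n])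
    qed
    then show ?thesis by (simp flip: sum.nat_group)
  qed
  \<comment> \<open>Abel summation with \<open>G j = M * W j - W (n * j)\<close>, which is
    nonnegative and vanishes at 0.\<close>
  have upper: "(\<Sum>i<J * n. f (i div n) * v i) \<le> M * (\<Sum>j<J. f j * v j)"
    if "\<And>j. W (n * j) \<le> M * W j" for M J
  proof -
    have "(\<Sum>j<J. f j * ((M * W (Suc j) - W (n * Suc j)) - (M * W j - W (n * j)))) =
        M * (\<Sum>j<J. f j * v j) - (\<Sum>j<J. f j * (W (n * Suc j) - W (n * j)))"
      unfolding sum_distrib_left sum_subtractf[symmetric]
      by (intro sum.cong) (auto simp: algebra_simps)
    then show ?thesis
      using abel_sum_nonneg[of f "\<lambda>j. M * W j - W (n * j)" J] f that unfolding group by simp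
  qed
  have lower: "(\<Sum>j<J. f j * v j) \<le> m * (\<Sum>i<J * n. f (i div n) * v i)"
    if "\<And>j. W j \<le> m * W (n * j)" for m J
  proof -
    have "(\<Sum>j<J. f j * ((m * W (n * Suc j) - W (Suc j)) - (m * W (n * j) - W j))) =
        m * (\<Sum>j<J. f j * (W (n * Suc j) - W (n * j))) - (\<Sum>j<J. f j * v j)"
      unfolding sum_distrib_left sum_subtractf[symmetric]
      by (intro sum.cong) (auto simp: algebra_simps)
    then show ?thesis
      using abel_sum_nonneg[of f "\<lambda>j. m * W (n * j) - W j" J] f that unfolding group by simp
  qed
  have nn: "0 \<le> f i * v j" for i j using f by simp
  have part: "(\<Sum>i<N. f (i div n) * v i) \<le> M * energy (x 1)"
    if M: "\<And>j. W (n * j) \<le> M * W j" for M N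
  proof -
    \<comment> \<open>Positivity comes from the hypothesis at \<open>j = 1\<close>; it lets the
      partial sums below be enlarged to \<open>energy (x 1)\<close>.\<close>
    have "0 < M"
    proof -
      have "0 < M * W 1" using M[of 1] W_pos[OF n] by (metis less_le_trans mult.right_neutral)
      then show ?thesis using W_pos[of 1] by (rule zero_less_mult_pos2) simp
    qed
    have "(\<Sum>i<N. f (i div n) * v i) \<le> (\<Sum>i<N * n. f (i div n) * v i)"
      using n nn by (intro sum_mono2) auto
    also have "\<dots> \<le> M * (\<Sum>j<N. f j * v j)" using upper M .
    also have "\<dots> \<le> M * energy (x 1)"
      unfolding E1 using \<open>0 < M\<close> nn s1 by (intro mult_left_mono sum_le_suminf) auto
    finally show ?thesis .
  qed
  \<comment> \<open>The constant \<open>M = n\<close> given by subadditivity of \<open>W\<close>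
    already bounds all partial sums.\<close>
  have s: "summable (\<lambda>i. f (i div n) * v i)"
    using part[OF W_mult_le] nn by (intro summableI_nonneg_bounded) auto
  show "0 \<le> energy (x 1)" unfolding E1 using s1 nn by (rule suminf_nonneg)
  show "0 \<le> energy (lincomb n (\<lambda>_. 1) x)" unfolding E using s nn by (rule suminf_nonneg)
  show "energy (lincomb n (\<lambda>_. 1) x) \<le> M * energy (x 1)" if "\<And>j. W (n * j) \<le> M * W j"
    unfolding E using part[OF that] s by (intro suminf_le_const) auto
  show "energy (x 1) \<le> m * energy (lincomb n (\<lambda>_. 1) x)"
    if m: "\<And>j. W j \<le> m * W (n * j)" "0 \<le> m"
  proof -
    have "(\<Sum>j<J. f j * v j) \<le> m * energy (lincomb n (\<lambda>_. 1) x)" for J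
    proof -
      have "(\<Sum>j<J. f j * v j) \<le> m * (\<Sum>i<J * n. f (i div n) * v i)" using lower m(1) .
      also have "\<dots> \<le> m * energy (lincomb n (\<lambda>_. 1) x)"
        unfolding E using m(2) nn s by (intro mult_left_mono sum_le_suminf) auto
      finally show ?thesis .
    qed
    then show ?thesis unfolding E1 using s1 by (intro suminf_le_const)
  qed
qed

section \<open>Dilation functions and the indices \<alpha> and \<beta>\<close>

definition upper_dil :: "nat \<Rightarrow> real" where
  "upper_dil n = (SUP j\<in>{1..}. (W (2 ^ n * j) / W j) powr (1 / q))"

definition lower_dil :: "nat \<Rightarrow> real" where
  "lower_dil n = (SUP j\<in>{1..}. (W j / W (2 ^ n * j)) powr (1 / q))"

lemma W_dilation:
  assumes "j \<ge> 1"
  shows "1 \<le> W (2 ^ n * j) / W j" and "W (2 ^ n * j) / W j \<le> 2 ^ n"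
    and "W (2 ^ n * j) > 0"
  using W_mono[of j "2 ^ n * j"] W_mult_le[of "2 ^ n" j] W_pos[of j] W_pos[of "2 ^ n * j"] assms
  by (auto simp: field_simps)

text \<open>The ratios telescope along \<open>j\<close>, \<open>2 ^ n * j\<close>,
  \<open>2 ^ (m + n) * j\<close>, which is the cocycle identity. Monotonicity of \<open>W\<close>
  bounds them below by 1, subadditivity bounds them above.\<close>

lemma
  shows beta_tendsto: "(\<lambda>n. (1 / real n) * log 2 (upper_dil n)) \<longlonglongrightarrow> lorentz_beta q w"
    and upper_dil_upper: "j \<ge> 1 \<Longrightarrow> (W (2 ^ n * j) / W j) powr (1 / q) \<le> upper_dil n"
    and upper_dil_attained:
      "0 < c \<Longrightarrow> c < 1 \<Longrightarrow>
        \<exists>j\<ge>1. c * 2 powr (real n * lorentz_beta q w) \<le> (W (2 ^ n * j) / W j) powr (1 / q)"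
proof -
  have 1: "(1::real) ^ n \<le> (W (2 ^ n * j) / W j) powr (1 / q)"
    and 2: "(W (2 ^ n * j) / W j) powr (1 / q) \<le> (2 ^ n) powr (1 / q)" if "j \<ge> 1" for n j
    using W_dilation[OF that, of n] W_pos[OF that] q by (auto intro!: ge_one_powr_ge_zero powr_mono2)
  have 3: "(W (2 ^ (m + n) * j) / W j) powr (1 / q) =
      (W (2 ^ m * (2 ^ n * j)) / W (2 ^ n * j)) powr (1 / q) * (W (2 ^ n * j) / W j) powr (1 / q)"
    if "j \<ge> 1" for m n j
    using W_dilation[OF that, of n] W_pos[OF that] W_dilation[OF that, of "m + n"] W_pos[OF that]
    by (subst powr_mult[symmetric]) (auto simp: power_add ac_simps)
  note * = cocycle_growth_rate[of 1 "\<lambda>n j. (W (2 ^ n * j) / W j) powr (1 / q)", OF zero_less_one 1 2 3]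
  show "(\<lambda>n. (1 / real n) * log 2 (upper_dil n)) \<longlonglongrightarrow> lorentz_beta q w"
    unfolding upper_dil_def lorentz_beta_def by (rule *(1))
  show "j \<ge> 1 \<Longrightarrow> (W (2 ^ n * j) / W j) powr (1 / q) \<le> upper_dil n"
    unfolding upper_dil_def by (rule *(2))
  show "0 < c \<Longrightarrow> c < 1 \<Longrightarrow>
        \<exists>j\<ge>1. c * 2 powr (real n * lorentz_beta q w) \<le> (W (2 ^ n * j) / W j) powr (1 / q)"
    unfolding lorentz_beta_def by (rule *(3))
qed

text \<open>The reciprocal ratios form a cocycle as well, now with lower bound
  \<open>2 powr (- n / q)\<close> and upper bound 1. Its rate is the negative of \<alpha>.\<close>

lemma
  shows alpha_tendsto: "(\<lambda>n. (1 / real n) * log 2 (lower_dil n)) \<longlonglongrightarrow> - lorentz_alpha q w"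
    and lower_dil_upper: "j \<ge> 1 \<Longrightarrow> (W j / W (2 ^ n * j)) powr (1 / q) \<le> lower_dil n"
    and lower_dil_attained:
      "0 < c \<Longrightarrow> c < 1 \<Longrightarrow>
        \<exists>j\<ge>1. c * 2 powr (real n * (- lorentz_alpha q w)) \<le> (W j / W (2 ^ n * j)) powr (1 / q)"
proof -
  have 0: "((1/2::real) powr (1 / q)) > 0" by simp
  have 1: "((1/2::real) powr (1 / q)) ^ n \<le> (W j / W (2 ^ n * j)) powr (1 / q)"
    and 2: "(W j / W (2 ^ n * j)) powr (1 / q) \<le> 1" if "j \<ge> 1" for n j
  proof -
    have "((1/2::real) powr (1 / q)) ^ n = ((1/2) ^ n) powr (1 / q)"
      by (simp add: powr_realpow[symmetric] powr_powr mult.commute)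
    also have "\<dots> \<le> (W j / W (2 ^ n * j)) powr (1 / q)"
      using W_dilation[OF that, of n] W_pos[OF that] q by (intro powr_mono2) (auto simp: field_simps)
    finally show "((1/2::real) powr (1 / q)) ^ n \<le> (W j / W (2 ^ n * j)) powr (1 / q)" .
    show "(W j / W (2 ^ n * j)) powr (1 / q) \<le> 1"
      using W_dilation[OF that, of n] W_pos[OF that] q by (intro powr_le1) (auto simp: field_simps)
  qed
  have 3: "(W j / W (2 ^ (m + n) * j)) powr (1 / q) =
      (W (2 ^ n * j) / W (2 ^ m * (2 ^ n * j))) powr (1 / q) * (W j / W (2 ^ n * j)) powr (1 / q)"
    if "j \<ge> 1" for m n j
    using W_dilation[OF that, of n] W_pos[OF that] W_dilation[OF that, of "m + n"] W_pos[OF that]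
    by (subst powr_mult[symmetric]) (auto simp: power_add ac_simps)
  note * = cocycle_growth_rate[of "(1/2) powr (1 / q)" "\<lambda>n j. (W j / W (2 ^ n * j)) powr (1 / q)" "\<lambda>_. 1",
      OF 0 1 2 3]
  show "(\<lambda>n. (1 / real n) * log 2 (lower_dil n)) \<longlonglongrightarrow> - lorentz_alpha q w"
    unfolding lower_dil_def lorentz_alpha_def minus_minus by (rule *(1))
  show "j \<ge> 1 \<Longrightarrow> (W j / W (2 ^ n * j)) powr (1 / q) \<le> lower_dil n"
    unfolding lower_dil_def by (rule *(2))
  show "0 < c \<Longrightarrow> c < 1 \<Longrightarrow>
        \<exists>j\<ge>1. c * 2 powr (real n * (- lorentz_alpha q w)) \<le> (W j / W (2 ^ n * j)) powr (1 / q)"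
    unfolding lorentz_alpha_def minus_minus by (rule *(3))
qed

lemma upper_dil_ge_1: "upper_dil n \<ge> 1"
  using upper_dil_upper[of 1 n] W_dilation(1)[of 1 n] q
    ge_one_powr_ge_zero[of "W (2 ^ n * 1) / W 1" "1 / q"] by auto

lemma lower_dil_pos: "lower_dil n > 0"
proof -
  have "0 < (W 1 / W (2 ^ n * 1)) powr (1 / q)" using W_dilation(3)[of 1 n] W_pos[of 1] by simp
  then show ?thesis using lower_dil_upper[of 1 n] by linarith
qed

lemma lower_dil_le_1: "lower_dil n \<le> 1"
proof -
  have "(W j / W (2 ^ n * j)) powr (1 / q) \<le> 1" if "j \<ge> 1" for j
    using W_dilation[OF that, of n] W_pos[OF that] q by (intro powr_le1) (auto simp: field_simps)
  then show ?thesis unfolding lower_dil_def by (intro cSUP_least) auto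
qed

lemma beta_nonneg: "lorentz_beta q w \<ge> 0"
proof -
  have "0 \<le> (1 / real n) * log 2 (upper_dil n)" for n
    using upper_dil_ge_1[of n] by simp
  then show ?thesis by (intro LIMSEQ_le_const[OF beta_tendsto]) auto
qed

lemma alpha_nonneg: "lorentz_alpha q w \<ge> 0"
proof -
  have "(1 / real n) * log 2 (lower_dil n) \<le> 0" for n
    using lower_dil_le_1[of n] lower_dil_pos[of n] by (simp add: divide_nonpos_nonneg)
  then have "- lorentz_alpha q w \<le> 0" by (intro LIMSEQ_le_const2[OF alpha_tendsto]) auto
  then show ?thesis by simp
qed

text \<open>For \<open>n = 2 ^ N\<close> the vector of ones has norm comparable to
  \<open>n powr (1 / p)\<close> and a single \<open>x 1\<close> has norm comparable to 1. The
  dilation functions bound the quotient of these norms from both sides.\<close>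

lemma crude_sym_fin_rep_imp_interval:
  assumes p: "1 \<le> p" and rep: "crude_sym_fin_rep p q w"
  shows "in_index_interval p (lorentz_alpha q w) (lorentz_beta q w)"
proof -
  define t where "t = inv_exponent p"
  obtain C where C: "C > 0" and ex: "\<And>n. \<exists>x :: nat \<Rightarrow> nat \<Rightarrow> real.
       (\<forall>k\<in>{1..n}. x k \<in> lorentz_space q w) \<and> disjointly_supported n x \<and>
       (\<forall>k\<in>{1..n}. \<forall>l\<in>{1..n}. same_ord_dist (x k) (x l)) \<and>
       (\<forall>a. lp_norm p n a / C \<le> lorentz_norm q w (lincomb n a x) \<and>
            lorentz_norm q w (lincomb n a x) \<le> C * lp_norm p n a)"
    using rep unfolding crude_sym_fin_rep_def disjointly_supported_def by blast
  have key: "2 powr (real N * t) \<le> C\<^sup>2 * upper_dil N" "2 powr (real N * (- t)) \<le> C\<^sup>2 * lower_dil N" for N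
  proof -
    define n :: nat where "n = 2 ^ N"
    have n: "n \<ge> 1" unfolding n_def by simp
    obtain x where mem: "\<And>k. k \<in> {1..n} \<Longrightarrow> x k \<in> lorentz_space q w"
      and dis: "disjointly_supported n x"
      and same: "\<And>k. k \<in> {1..n} \<Longrightarrow> same_ord_dist (x 1) (x k)"
      and est: "\<And>a. lp_norm p n a / C \<le> lorentz_norm q w (lincomb n a x)"
        "\<And>a. lorentz_norm q w (lincomb n a x) \<le> C * lp_norm p n a"
      using ex[of n] n by (metis atLeastAtMost_iff order_refl)
    let ?S = "lincomb n (\<lambda>_. 1) x"
    have bdd: "bdd_above (range (\<lambda>j. \<bar>x k j\<bar>))" if "k \<in> {1..n}" for k
      using mem[OF that] by (simp add: lorentz_space_def)
    have b1: "bdd_above (range (\<lambda>j. \<bar>x 1 j\<bar>))" using bdd n by auto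
    have bS: "bdd_above (range (\<lambda>j. \<bar>?S j\<bar>))" using bdd by (rule bdd_lincomb)
    have "lincomb n (\<lambda>k. if k = 1 then 1 else 0) x = (\<lambda>i. \<Sum>k=1..n. if k = 1 then x k i else 0)"
      unfolding lincomb_def by (intro ext sum.cong) auto
    then have x1: "lincomb n (\<lambda>k. if k = 1 then 1 else 0) x = x 1" using n by simp
    have pn: "real n powr t = 2 powr (real N * t)"
      unfolding n_def by (simp add: powr_realpow[symmetric] powr_powr)
    define X where "X = lorentz_norm q w (x 1)"
    define Y where "Y = lorentz_norm q w ?S"
    have X: "1 / C \<le> X" "X \<le> C"
      using est[of "\<lambda>k. if k = 1 then 1 else 0"] lp_norm_unit[OF n, of p] unfolding x1 X_def by auto
    have Y: "2 powr (real N * t) / C \<le> Y" "Y \<le> C * 2 powr (real N * t)"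
      using est[of "\<lambda>_. 1"] lp_norm_ones[OF n, of p] pn unfolding Y_def t_def[symmetric] by auto
    have powr_q: "(z powr q) powr (1 / q) = z" if "z \<ge> 0" for z :: real
      using that q by (simp add: powr_powr)
    have "W (n * j) \<le> upper_dil N powr q * W j" for j
    proof (cases "j \<ge> 1")
      case True
      have "((W (2 ^ N * j) / W j) powr (1 / q)) powr q \<le> upper_dil N powr q"
        using upper_dil_upper[OF True] q by (intro powr_mono2) auto
      then show ?thesis using W_dilation[OF True, of N] W_pos[OF True] q
        by (simp add: powr_powr n_def field_simps)
    qed (simp add: not_le)
    then have "energy ?S \<le> upper_dil N powr q * energy (x 1)"
      by (intro energy_copies(1)[OF n dis mem same])
    then have "Y \<le> (upper_dil N powr q * energy (x 1)) powr (1 / q)"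
      unfolding Y_def lorentz_norm_eq[OF bS] using energy_copies(4)[OF n dis mem same] q
      by (intro powr_mono2) auto
    also have "\<dots> = upper_dil N * X"
      unfolding X_def lorentz_norm_eq[OF b1] using upper_dil_ge_1[of N] powr_q[of "upper_dil N"]
        energy_copies(3)[OF n dis mem same] by (simp add: powr_mult)
    also have "\<dots> \<le> upper_dil N * C" using X upper_dil_ge_1[of N] by (intro mult_left_mono) auto
    finally have "2 powr (real N * t) / C \<le> upper_dil N * C" using Y(1) by simp
    then show "2 powr (real N * t) \<le> C\<^sup>2 * upper_dil N"
      using C by (simp add: field_simps power2_eq_square)
    have "W j \<le> lower_dil N powr q * W (n * j)" for j
    proof (cases "j \<ge> 1")
      case True
      have "((W j / W (2 ^ N * j)) powr (1 / q)) powr q \<le> lower_dil N powr q"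
        using lower_dil_upper[OF True] q by (intro powr_mono2) auto
      then show ?thesis using W_dilation[OF True, of N] W_pos[OF True] q
        by (simp add: powr_powr n_def field_simps)
    qed (simp add: not_le)
    then have "energy (x 1) \<le> lower_dil N powr q * energy ?S"
      by (intro energy_copies(2)[OF n dis mem same]) auto
    then have "X \<le> (lower_dil N powr q * energy ?S) powr (1 / q)"
      unfolding X_def lorentz_norm_eq[OF b1] using energy_copies(3)[OF n dis mem same] q
      by (intro powr_mono2) auto
    also have "\<dots> = lower_dil N * Y"
      unfolding Y_def lorentz_norm_eq[OF bS] using lower_dil_pos[of N] powr_q[of "lower_dil N"]
        energy_copies(4)[OF n dis mem same] by (simp add: powr_mult)
    also have "\<dots> \<le> lower_dil N * (C * 2 powr (real N * t))"
      using Y lower_dil_pos[of N] by (intro mult_left_mono) auto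
    finally have "1 / C \<le> lower_dil N * (C * 2 powr (real N * t))" using X(1) by simp
    then show "2 powr (real N * (- t)) \<le> C\<^sup>2 * lower_dil N"
      using C by (simp add: field_simps power2_eq_square powr_minus)
  qed
  \<comment> \<open>The factor \<open>C\<^sup>2\<close> does not depend on \<open>N\<close> and
    disappears in the growth rate.\<close>
  have "t \<le> lorentz_beta q w"
    using C upper_dil_ge_1 key(1)
    by (intro le_rate_if_le_power[OF beta_tendsto, of "C\<^sup>2"]) (auto intro: less_le_trans[OF zero_less_one])
  moreover have "- t \<le> - lorentz_alpha q w"
    using C lower_dil_pos key(2) by (intro le_rate_if_le_power[OF alpha_tendsto, of "C\<^sup>2"]) auto
  ultimately show ?thesis
    using in_index_interval_iff[OF p alpha_nonneg beta_nonneg] unfolding t_def by simp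
qed

end

section \<open>Blocks with a common pattern\<close>

lemma mono_upto:
  fixes m :: "nat \<Rightarrow> nat"
  assumes "\<forall>k<n. m k < m (Suc k)" and "k \<le> l" and "l \<le> n"
  shows "m k \<le> m l"
  using assms(2,3)
proof (induction l rule: dec_induct)
  case (step l)
  then have "m l < m (Suc l)" using assms(1) by auto
  with step show ?case by simp
qed simp

lemma block_vec_disjoint:
  assumes "\<forall>k<n. m k < m (Suc k)"
  shows "disjointly_supported n (block_vec m \<alpha>)"
proof -
  have "block_vec m \<alpha> k i = 0 \<or> block_vec m \<alpha> l i = 0" if "k < l" "l \<le> n" for k l i
  proof -
    have "m k \<le> m (l - 1)" using mono_upto[OF assms, of k "l - 1"] that by simp
    then show ?thesis unfolding block_vec_def by auto
  qed
  then show ?thesis unfolding disjointly_supported_def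
    by (metis atLeastAtMost_iff linorder_neqE_nat)
qed

text \<open>Translates of one pattern of length \<open>L\<close>. Their coefficient lists coincide,
  so the identity permutation witnesses the equal ordered distribution.\<close>

abbreviation periodic_blocks :: "nat \<Rightarrow> (nat \<Rightarrow> real) \<Rightarrow> nat \<Rightarrow> nat \<Rightarrow> real" where
  "periodic_blocks L h \<equiv> block_vec (\<lambda>k. k * L) (\<lambda>i. h (i mod L))"

lemma periodic_blocks_level_set:
  assumes "k \<ge> 1" "0 \<le> t"
  shows "{i. \<bar>c * periodic_blocks L h k i\<bar> > t} = (\<lambda>j. (k - 1) * L + j) ` {j. j < L \<and> \<bar>c * h j\<bar> > t}"
proof -
  obtain l where k: "k = Suc l" using assms(1) by (cases k) auto
  have eq: "periodic_blocks L h k (l * L + j) = h j" if "j < L" for j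
    using that by (simp add: block_vec_def k)
  show ?thesis
  proof (intro equalityI subsetI)
    fix i assume i: "i \<in> {i. \<bar>c * periodic_blocks L h k i\<bar> > t}"
    then have "periodic_blocks L h k i \<noteq> 0" using assms(2) by auto
    then have range: "l * L \<le> i" "i < l * L + L" unfolding block_vec_def k by (auto split: if_splits)
    define j where "j = i - l * L"
    have j: "i = l * L + j" "j < L" unfolding j_def using range by auto
    with i eq[OF j(2)] show "i \<in> (\<lambda>j. (k - 1) * L + j) ` {j. j < L \<and> \<bar>c * h j\<bar> > t}"
      unfolding k by auto
  qed (use eq in \<open>auto simp: k\<close>)
qed

lemma periodic_blocks_disjoint:
  assumes "L \<ge> 1"
  shows "disjointly_supported n (periodic_blocks L h)"
  by (rule block_vec_disjoint) (use assms in auto)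

lemma lincomb_periodic_blocks_eq_0:
  assumes "i \<ge> n * L"
  shows "lincomb n a (periodic_blocks L h) i = 0"
proof (rule lincomb_eq_0)
  fix k assume "k \<in> {1..n}"
  then have "k * L \<le> i" using assms by (meson atLeastAtMost_iff le_trans mult_le_mono1)
  then show "periodic_blocks L h k i = 0" by (simp add: block_vec_def)
qed

lemma bdd_periodic_blocks: "bdd_above (range (\<lambda>j. \<bar>lincomb n a (periodic_blocks L h) j\<bar>))"
  by (rule bdd_above_if_eventually_zero[OF lincomb_periodic_blocks_eq_0])

lemma decr_rearr_periodic_blocks_le_iff:
  assumes "L \<ge> 1" "0 \<le> t"
  shows "decr_rearr (lincomb n a (periodic_blocks L h)) i \<le> t \<longleftrightarrow>
    (\<Sum>k=1..n. card {j. j < L \<and> \<bar>a k * h j\<bar> > t}) \<le> i"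
proof -
  note dis = periodic_blocks_disjoint[OF assms(1), of n h]
  have fin: "finite {i. \<bar>a k * periodic_blocks L h k i\<bar> > t}"
    and card: "card {i. \<bar>a k * periodic_blocks L h k i\<bar> > t} = card {j. j < L \<and> \<bar>a k * h j\<bar> > t}"
    if "k \<in> {1..n}" for k
    using that assms(2) by (auto simp: periodic_blocks_level_set card_image)
  have "finite {i. \<bar>lincomb n a (periodic_blocks L h) i\<bar> > t}"
    unfolding lincomb_level_set[OF dis assms(2)] using fin by blast
  moreover have "card {i. \<bar>lincomb n a (periodic_blocks L h) i\<bar> > t} =
      (\<Sum>k=1..n. card {j. j < L \<and> \<bar>a k * h j\<bar> > t})"
  proof -
    have "card {i. \<bar>lincomb n a (periodic_blocks L h) i\<bar> > t} =
        (\<Sum>k=1..n. card {i. \<bar>a k * periodic_blocks L h k i\<bar> > t})"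
      by (rule card_lincomb_level_set[OF dis assms(2)]) (rule fin)
    also have "\<dots> = (\<Sum>k=1..n. card {j. j < L \<and> \<bar>a k * h j\<bar> > t})"
      by (intro sum.cong refl card)
    finally show ?thesis .
  qed
  ultimately show ?thesis
    using decr_rearr_le_iff[OF bdd_periodic_blocks, of n a L h i t] by simp
qed

text \<open>Counts the integers 1, 2, ... below \<open>y\<close>, shifted by one since positions
  start at 0. The strict upper bound later turns a total below \<open>i + 1\<close> into one of at
  most \<open>i\<close>.\<close>

lemma finite_less_real: "finite {j. real j + 1 < y}"
  and card_less_real: "y > 0 \<Longrightarrow> real (card {j. real j + 1 < y}) < y"
  and card_less_real_ge: "y - 1 \<le> real (card {j. real j + 1 < y})"
proof -
  have eq: "{j. real j + 1 < y} = {..<nat (\<lceil>y\<rceil> - 1)}"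
    by (auto simp: less_ceiling_iff zless_nat_eq_int_zless) linarith+
  show "finite {j. real j + 1 < y}" unfolding eq by simp
  show "real (card {j. real j + 1 < y}) < y" if "y > 0"
    unfolding eq using that by (simp add: of_nat_nat) linarith
  show "y - 1 \<le> real (card {j. real j + 1 < y})"
    unfolding eq by simp linarith
qed

text \<open>Solves the level condition for the position \<open>X\<close>, so that level sets of the
  power pattern become initial segments.\<close>

lemma less_mult_powr_iff:
  fixes a t X P :: real
  assumes "a > 0" "t > 0" "X > 0" "P > 0"
  shows "t < a * X powr (- (1 / P)) \<longleftrightarrow> X < (a / t) powr P"
proof -
  define z where "z = X powr (1 / P)"
  have z: "z > 0" "X = z powr P" unfolding z_def using assms by (auto simp: powr_powr)
  have "t < a * X powr (- (1 / P)) \<longleftrightarrow> z < a / t"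
    unfolding powr_minus z_def[symmetric] using z assms by (simp add: field_simps)
  also have "\<dots> \<longleftrightarrow> z powr P < (a / t) powr P"
    using z(1) assms by (meson less_imp_le not_le powr_less_mono2 powr_mono2 divide_pos_pos)
  finally show ?thesis using z(2) by simp
qed

lemma powr_scaled_power:
  fixes B X P :: real
  assumes "B \<ge> 0" "X > 0" "P > 0"
  shows "(B * X powr (- (1 / P))) powr P = B powr P / X"
  using assms by (simp add: powr_mult powr_powr powr_neg_one)

section \<open>Block representations from energy estimates\<close>

context lorentz_weight
begin

lemma eventually_zero_in_lorentz_space:
  assumes "\<And>i. i \<ge> N \<Longrightarrow> a i = 0"
  shows "a \<in> lorentz_space q w"
proof -
  have "summable (\<lambda>k. (decr_rearr a k * w k) powr q)"
    using decr_rearr_eq_0[of N a] assms by (intro summable_finite[of "{..<N}"]) auto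
  then show ?thesis
    unfolding lorentz_space_def using bdd_above_if_eventually_zero[of N a] assms by auto
qed

lemma energy_eventually_zero:
  assumes "\<And>i. i \<ge> N \<Longrightarrow> a i = 0"
  shows "energy a = (\<Sum>i<N. decr_rearr a i powr q * v i)"
  unfolding energy_def
  using decr_rearr_eq_0[of N a] assms by (intro suminf_finite) auto

text \<open>Reduces the task to an energy estimate up to a common factor \<open>K\<close>. Scaling
  the pattern removes \<open>K\<close>, and taking \<open>q\<close>-th roots does not worsen the
  factor \<open>1 + \<epsilon>\<close> because \<open>q \<ge> 1\<close>.\<close>

lemma sym_block_fin_rep_I:
  assumes p: "1 \<le> p"
    and ex: "\<And>n \<epsilon>. n \<ge> 1 \<Longrightarrow> \<epsilon> > 0 \<Longrightarrow> \<exists>L h K. L \<ge> 1 \<and> K > 0 \<and>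
      (\<forall>a. K * lp_norm p n a powr q / (1 + \<epsilon>) \<le> energy (lincomb n a (periodic_blocks L h)) \<and>
        energy (lincomb n a (periodic_blocks L h)) \<le> (1 + \<epsilon>) * (K * lp_norm p n a powr q))"
  shows "sym_block_fin_rep p q w"
  unfolding sym_block_fin_rep_def
proof (intro allI impI)
  fix n :: nat and \<epsilon> :: real assume \<epsilon>: "\<epsilon> > 0"
  obtain L h K where L: "L \<ge> 1" and K: "K > 0"
    and lower: "\<And>a. K * lp_norm p n a powr q / (1 + \<epsilon>) \<le> energy (lincomb n a (periodic_blocks L h))"
    and upper: "\<And>a. energy (lincomb n a (periodic_blocks L h)) \<le> (1 + \<epsilon>) * (K * lp_norm p n a powr q)"
  proof (cases "n \<ge> 1")
    case True
    from ex[OF this \<epsilon>] that show thesis by metis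
  next
    \<comment> \<open>With no blocks at all both sides vanish, and any pattern of length one will
      do.\<close>
    case False
    then have n: "n = 0" by simp
    have "lp_norm p 0 a = 0" for a by (simp add: lp_norm_def)
    moreover have "energy (lincomb 0 a (periodic_blocks 1 h)) = 0" for a h
      by (subst energy_eventually_zero[of 0]) (auto simp: lincomb_def)
    ultimately show thesis using that[of 1 1] unfolding n by simp
  qed
  define \<kappa> where "\<kappa> = K powr (- 1 / q)"
  have \<kappa>: "\<kappa> > 0" "K * \<kappa> powr q = 1"
  proof -
    show "\<kappa> > 0" unfolding \<kappa>_def using K by simp
    have "\<kappa> powr q = K powr (-1)" unfolding \<kappa>_def using q by (simp add: powr_powr)
    then show "K * \<kappa> powr q = 1" using K by (simp add: powr_neg_one)
  qed
  define \<alpha> where "\<alpha> i = \<kappa> * h (i mod L)" for i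
  let ?m = "\<lambda>k. k * L"
  have "block_coeffs ?m \<alpha> k = map (\<lambda>j. \<kappa> * h j) [0..<L]" if "k \<ge> 1" for k
  proof (rule nth_equalityI)
    have len: "k * L - (k - 1) * L = L" using that by (simp add: diff_mult_distrib)
    then show "length (block_coeffs ?m \<alpha> k) = length (map (\<lambda>j. \<kappa> * h j) [0..<L])"
      by (simp add: block_coeffs_def)
    fix i assume "i < length (block_coeffs ?m \<alpha> k)"
    then have "i < L" by (simp only: block_coeffs_def length_map length_upt len)
    then have "block_coeffs ?m \<alpha> k ! i = \<alpha> ((k - 1) * L + i)"
      unfolding block_coeffs_def by (intro nth_map_upt) (simp only: len)
    then show "block_coeffs ?m \<alpha> k ! i = map (\<lambda>j. \<kappa> * h j) [0..<L] ! i"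
      using \<open>i < L\<close> by (simp add: \<alpha>_def)
  qed
  moreover have "same_ord_dist_block xs xs" for xs
    unfolding same_ord_dist_block_def by (auto intro!: exI[of _ id] simp: permutes_id)
  ultimately have same: "\<forall>k\<in>{1..n}. \<forall>l\<in>{1..n}.
      same_ord_dist_block (block_coeffs ?m \<alpha> k) (block_coeffs ?m \<alpha> l)" by simp
  have est: "lp_norm p n a / (1 + \<epsilon>) \<le> lorentz_norm q w (lincomb n a (block_vec ?m \<alpha>)) \<and>
      lorentz_norm q w (lincomb n a (block_vec ?m \<alpha>)) \<le> (1 + \<epsilon>) * lp_norm p n a" for a
  proof -
    define B where "B = lp_norm p n a"
    have B: "B \<ge> 0" unfolding B_def by (rule lp_norm_nonneg)
    define E where "E = energy (lincomb n (\<lambda>k. \<kappa> * a k) (periodic_blocks L h))"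
    \<comment> \<open>The scaling of the blocks moves into the coefficients, where the estimate for
      the unscaled pattern applies.\<close>
    have "lincomb n a (block_vec ?m \<alpha>) = lincomb n (\<lambda>k. \<kappa> * a k) (periodic_blocks L h)"
      unfolding lincomb_def block_vec_def \<alpha>_def by (intro ext sum.cong) auto
    then have norm: "lorentz_norm q w (lincomb n a (block_vec ?m \<alpha>)) = E powr (1 / q)"
      unfolding E_def using lorentz_norm_eq[OF bdd_periodic_blocks] by simp
    have KB: "K * lp_norm p n (\<lambda>k. \<kappa> * a k) powr q = B powr q"
      unfolding B_def using \<kappa> p
      by (simp add: lp_norm_scale powr_mult mult.assoc[symmetric] lp_norm_nonneg)
    have Bq: "(B powr q) powr (1 / q) = B" using B q by (simp add: powr_powr)
    have e1: "(1 + \<epsilon>) powr (1 / q) \<le> 1 + \<epsilon>"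
      using powr_mono[of "1 / q" 1 "1 + \<epsilon>"] \<epsilon> q by simp
    have "B / (1 + \<epsilon>) \<le> B / (1 + \<epsilon>) powr (1 / q)"
      using e1 B \<epsilon> by (intro divide_left_mono) auto
    also have "\<dots> = (B powr q / (1 + \<epsilon>)) powr (1 / q)"
      using Bq \<epsilon> by (simp add: powr_divide)
    also have "\<dots> \<le> E powr (1 / q)"
      using lower[of "\<lambda>k. \<kappa> * a k"] KB \<epsilon> q unfolding E_def by (intro powr_mono2) auto
    finally have 1: "B / (1 + \<epsilon>) \<le> E powr (1 / q)" .
    have "0 \<le> B powr q / (1 + \<epsilon>)" using \<epsilon> by simp
    then have "0 \<le> E"
      using lower[of "\<lambda>k. \<kappa> * a k", unfolded KB] unfolding E_def by (rule order_trans)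
    then have "E powr (1 / q) \<le> ((1 + \<epsilon>) * B powr q) powr (1 / q)"
      using upper[of "\<lambda>k. \<kappa> * a k"] KB q unfolding E_def by (intro powr_mono2) auto
    also have "\<dots> = (1 + \<epsilon>) powr (1 / q) * B"
      using Bq \<epsilon> by (simp add: powr_mult)
    also have "\<dots> \<le> (1 + \<epsilon>) * B" using e1 B by (rule mult_right_mono)
    finally show ?thesis using 1 norm unfolding B_def by simp
  qed
  show "\<exists>m \<alpha>. m 0 = 0 \<and> (\<forall>k<n. m k < m (Suc k)) \<and>
       (\<forall>k\<in>{1..n}. \<forall>l\<in>{1..n}. same_ord_dist_block (block_coeffs m \<alpha> k) (block_coeffs m \<alpha> l)) \<and>
       (\<forall>a. lp_norm p n a / (1 + \<epsilon>) \<le> lorentz_norm q w (lincomb n a (block_vec m \<alpha>)) \<and>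
            lorentz_norm q w (lincomb n a (block_vec m \<alpha>)) \<le> (1 + \<epsilon>) * lp_norm p n a)"
    using L same est by (intro exI[of _ ?m] exI[of _ \<alpha>]) auto
qed

text \<open>A vanishing \<alpha> provides lengths \<open>L\<close> for which
  \<open>W (n * L)\<close> is nearly \<open>W L\<close>. With constant blocks of such a length, the
  rearrangement equals the maximum of the coefficients on the first \<open>L\<close> places, and
  what follows has little weight.\<close>

lemma sym_block_fin_rep_infinity:
  assumes "lorentz_alpha q w = 0"
  shows "sym_block_fin_rep \<infinity> q w"
proof (rule sym_block_fin_rep_I)
  fix n :: nat and \<epsilon> :: real assume n: "n \<ge> 1" and \<epsilon>: "\<epsilon> > 0"
  \<comment> \<open>Chosen so that the \<open>q\<close>-th power of the near-attainment inequality
    yields exactly the factor \<open>1 + \<epsilon>\<close>.\<close>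
  define c where "c = (1 / (1 + \<epsilon>)) powr (1 / q)"
  have c: "0 < c" "c < 1" "c powr q = 1 / (1 + \<epsilon>)"
    unfolding c_def using \<epsilon> q powr_less_mono2[of "1 / q" "1 / (1 + \<epsilon>)" 1] by (auto simp: powr_powr)
  obtain L where L: "L \<ge> 1" "c \<le> (W L / W (2 ^ n * L)) powr (1 / q)"
    using lower_dil_attained[OF c(1,2), of n] assms by auto
  have "c powr q \<le> ((W L / W (2 ^ n * L)) powr (1 / q)) powr q"
    using L(2) c(1) q by (intro powr_mono2) auto
  then have "W (2 ^ n * L) \<le> (1 + \<epsilon>) * W L"
    using c(3) W_dilation[OF L(1), of n] W_pos[OF L(1)] q \<epsilon> by (simp add: powr_powr field_simps)
  moreover have "n \<le> 2 ^ n" by simp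
  then have "W (n * L) \<le> W (2 ^ n * L)" by (intro W_mono) simp
  ultimately have WL: "W (n * L) \<le> (1 + \<epsilon>) * W L" by linarith
  let ?h = "\<lambda>_. 1 :: real"
  have "W L * lp_norm \<infinity> n a powr q / (1 + \<epsilon>) \<le> energy (lincomb n a (periodic_blocks L ?h)) \<and>
        energy (lincomb n a (periodic_blocks L ?h)) \<le> (1 + \<epsilon>) * (W L * lp_norm \<infinity> n a powr q)" for a
  proof -
    define B where "B = lp_norm \<infinity> n a"
    have B0: "B \<ge> 0" unfolding B_def by (rule lp_norm_nonneg)
    have B_Max: "B = Max (insert 0 ((\<lambda>k. \<bar>a k\<bar>) ` {1..n}))"
      by (simp only: B_def lp_norm_def simp_thms if_True)
    have aB: "\<bar>a k\<bar> \<le> B" if "k \<in> {1..n}" for k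
      unfolding B_Max using that by (intro Max_ge) auto
    define d where "d = decr_rearr (lincomb n a (periodic_blocks L ?h))"
    have d0: "0 \<le> d i" for i unfolding d_def by (rule decr_rearr_nonneg[OF bdd_periodic_blocks])
    have "(\<Sum>k=1..n. card {j. j < L \<and> \<bar>a k * 1\<bar> > B}) = 0"
    proof (rule sum.neutral, rule ballI)
      fix k assume "k \<in> {1..n}"
      then have "{j. j < L \<and> \<bar>a k * 1\<bar> > B} = {}" using aB[of k] by auto
      then show "card {j. j < L \<and> \<bar>a k * 1\<bar> > B} = 0" by (simp only: card.empty)
    qed
    then have d_le: "d i \<le> B" for i
      using decr_rearr_periodic_blocks_le_iff[OF L(1) B0, of n a ?h i] unfolding d_def by linarith
    \<comment> \<open>A coefficient attaining the maximum contributes a full block of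
      \<open>L\<close> entries of that size.\<close>
    have d_ge: "B \<le> d i" if "i < L" for i
    proof (rule ccontr)
      assume "\<not> B \<le> d i"
      then have less: "d i < B" by simp
      have "B \<in> insert 0 ((\<lambda>k. \<bar>a k\<bar>) ` {1..n})"
        unfolding B_Max by (intro Max_in) auto
      then obtain k where k: "k \<in> {1..n}" "\<bar>a k\<bar> = B" using less d0[of i] by auto
      have "L = card {j. j < L \<and> \<bar>a k * 1\<bar> > d i}" using k(2) less by simp
      also have "\<dots> \<le> (\<Sum>k=1..n. card {j. j < L \<and> \<bar>a k * 1\<bar> > d i})"
        using k(1) by (intro member_le_sum[of k _ "\<lambda>k. card {j. j < L \<and> \<bar>a k * 1\<bar> > d i}"]) auto
      also have "\<dots> \<le> i"
        using decr_rearr_periodic_blocks_le_iff[OF L(1) d0[of i], of n a ?h i] by (simp add: d_def)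
      finally show False using that by simp
    qed
    have E: "energy (lincomb n a (periodic_blocks L ?h)) = (\<Sum>i<n * L. d i powr q * v i)"
      unfolding d_def by (rule energy_eventually_zero[OF lincomb_periodic_blocks_eq_0])
    have "W L * B powr q / (1 + \<epsilon>) \<le> W L * B powr q / 1"
      using \<epsilon> W_nonneg by (intro divide_left_mono) auto
    also have "\<dots> = (\<Sum>i<L. B powr q * v i)"
      by (simp add: wsum_def sum_distrib_left mult.commute)
    also have "\<dots> \<le> (\<Sum>i<L. d i powr q * v i)"
      using d_ge B0 q by (intro sum_mono mult_right_mono powr_mono2) auto
    also have "\<dots> \<le> (\<Sum>i<n * L. d i powr q * v i)"
      using n by (intro sum_mono2) auto
    finally have 1: "W L * B powr q / (1 + \<epsilon>) \<le> (\<Sum>i<n * L. d i powr q * v i)" .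
    have "(\<Sum>i<n * L. d i powr q * v i) \<le> (\<Sum>i<n * L. B powr q * v i)"
      using d_le d0 q by (intro sum_mono mult_right_mono powr_mono2) auto
    also have "\<dots> = B powr q * W (n * L)" by (simp add: wsum_def sum_distrib_left)
    also have "\<dots> \<le> B powr q * ((1 + \<epsilon>) * W L)" using WL by (intro mult_left_mono) auto
    finally show ?thesis using 1 unfolding E B_def by (simp add: ac_simps)
  qed
  then show "\<exists>L h K. L \<ge> 1 \<and> K > 0 \<and>
      (\<forall>a. K * lp_norm \<infinity> n a powr q / (1 + \<epsilon>) \<le> energy (lincomb n a (periodic_blocks L h)) \<and>
        energy (lincomb n a (periodic_blocks L h)) \<le> (1 + \<epsilon>) * (K * lp_norm \<infinity> n a powr q))"
    using L(1) W_pos[OF L(1)] by (intro exI[of _ L] exI[of _ ?h] exI[of _ "W L"] conjI allI) auto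
qed simp

end

text \<open>The block pattern \<open>j powr (- 1 / P)\<close> is truncated at \<open>A\<close> and \<open>L\<close>. Without truncations the level
  sets of a combination would have the size of those of one block scaled by the \<open>P\<close>-norm of the
  coefficients, up to rounding.\<close>

locale power_blocks = lorentz_weight +
  fixes P :: real and A L n :: nat
  assumes P: "1 \<le> P" and A: "1 \<le> A" and AL: "A \<le> L" and n: "1 \<le> n"
begin

definition pattern :: "nat \<Rightarrow> real" where
  "pattern j = real (max A (j + 1)) powr (- (1 / P))"

definition profile :: "nat \<Rightarrow> real" where
  "profile i = real (max A (i + 1)) powr (- (q / P))"

text \<open>The energy of a single block, since the pattern is nonincreasing and thus its own
  rearrangement. It serves as the common factor \<open>K\<close>.\<close>

definition mass :: real where
  "mass = (\<Sum>i<L. profile i * v i)"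

lemma profile_eq: "profile i = pattern i powr q"
  by (simp add: profile_def pattern_def powr_powr)

lemma pattern_pos: "pattern j > 0"
  unfolding pattern_def using A by simp

lemma L: "1 \<le> L"
  using A AL by simp

lemma mass_pos: "mass > 0"
  unfolding mass_def profile_eq using L pattern_pos v_pos
  by (intro sum_pos) (auto simp: lessThan_empty_iff less_imp_neq[symmetric])

lemma profile_le: "i + 1 \<ge> m \<Longrightarrow> m \<ge> 1 \<Longrightarrow> profile i \<le> real m powr (- (q / P))"
  unfolding profile_def using P q by (intro powr_mono2') auto

context
  fixes a :: "nat \<Rightarrow> real"
begin

definition "coef_norm = lp_norm (ereal P) n a"

definition "rearr = decr_rearr (lincomb n a (periodic_blocks L pattern))"

lemma coef_norm_nonneg: "coef_norm \<ge> 0"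
  unfolding coef_norm_def by (rule lp_norm_nonneg)

lemma rearr_nonneg: "rearr i \<ge> 0"
  unfolding rearr_def by (rule decr_rearr_nonneg[OF bdd_periodic_blocks])

lemma coef_norm_powr: "coef_norm powr P = (\<Sum>k=1..n. \<bar>a k\<bar> powr P)"
proof -
  have "coef_norm = (\<Sum>k=1..n. \<bar>a k\<bar> powr P) powr (1 / P)"
    by (simp add: coef_norm_def lp_norm_def)
  then show ?thesis using P by (simp add: powr_powr sum_nonneg)
qed

text \<open>Each summand is the number of positions of block \<open>k\<close> above the level
  \<open>coef_norm * X powr (- 1 / P)\<close>, disregarding rounding and truncation. These ideal
  counts add up to \<open>X\<close>.\<close>

lemma sum_scaled_powr:
  assumes "coef_norm \<noteq> 0" and "X > 0"
  shows "(\<Sum>k=1..n. (\<bar>a k\<bar> / (coef_norm * X powr (- (1 / P)))) powr P) = X"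
proof -
  have "(\<bar>a k\<bar> / (coef_norm * X powr (- (1 / P)))) powr P = \<bar>a k\<bar> powr P / (coef_norm powr P / X)" for k
    using assms coef_norm_nonneg P powr_scaled_power[of coef_norm X P] by (simp add: powr_divide)
  then show ?thesis
    using assms by (simp only: sum_divide_distrib[symmetric] coef_norm_powr[symmetric]) simp
qed

lemma abs_le_coef_norm:
  assumes "k \<in> {1..n}"
  shows "\<bar>a k\<bar> \<le> coef_norm"
proof -
  have "\<bar>a k\<bar> powr P \<le> coef_norm powr P"
    unfolding coef_norm_powr using assms by (intro member_le_sum) auto
  then show ?thesis
    using P coef_norm_nonneg by (meson abs_ge_zero not_le powr_less_mono2 less_le_trans zero_less_one)
qed

lemma rearr_le_iff:
  assumes "0 \<le> t"
  shows "rearr i \<le> t \<longleftrightarrow> (\<Sum>k=1..n. card {j. j < L \<and> \<bar>a k\<bar> * pattern j > t}) \<le> i"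
  unfolding rearr_def decr_rearr_periodic_blocks_le_iff[OF L assms]
  using pattern_pos by (simp add: abs_mult less_imp_le)

text \<open>On the flattened part no entry is larger than the bound. Elsewhere truncation and
  rounding only lower the ideal counts, whose total is \<open>i + 1\<close>.\<close>

lemma rearr_le: "rearr i \<le> coef_norm * pattern i"
proof (cases "i + 1 \<le> A")
  case True
  then have "pattern j \<le> pattern i" for j
    unfolding pattern_def using P A by (intro powr_mono2') auto
  then have "\<bar>a k\<bar> * pattern j \<le> coef_norm * pattern i" if "k \<in> {1..n}" for k j
    using abs_le_coef_norm[OF that] coef_norm_nonneg pattern_pos[of j] by (intro mult_mono) auto
  then have "{j. j < L \<and> \<bar>a k\<bar> * pattern j > coef_norm * pattern i} = {}" if "k \<in> {1..n}" for k
    using that by (auto simp: not_less)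
  then have "(\<Sum>k=1..n. card {j. j < L \<and> \<bar>a k\<bar> * pattern j > coef_norm * pattern i}) = 0"
    by (intro sum.neutral) (metis card.empty)
  moreover have "0 \<le> coef_norm * pattern i" using coef_norm_nonneg pattern_pos[of i] by simp
  ultimately show ?thesis using rearr_le_iff[of "coef_norm * pattern i" i] by linarith
next
  case False
  then have pat: "pattern i = real (i + 1) powr (- (1 / P))" by (simp add: pattern_def)
  show ?thesis
  proof (cases "coef_norm = 0")
    case True
    then have "a k = 0" if "k \<in> {1..n}" for k using abs_le_coef_norm[OF that] by simp
    then show ?thesis using rearr_le_iff[of 0 i] True by simp
  next
    case False
    define t where "t = coef_norm * pattern i"
    have t: "t > 0" unfolding t_def using False coef_norm_nonneg pattern_pos[of i] by simp
    define y where "y k = (\<bar>a k\<bar> / t) powr P" for k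
    have sum_y: "(\<Sum>k=1..n. y k) = real (i + 1)"
      unfolding y_def t_def pat using False by (intro sum_scaled_powr) auto
    have card_less: "real (card {j. j < L \<and> \<bar>a k\<bar> * pattern j > t}) < y k" if "a k \<noteq> 0" for k
    proof -
      have "{j. j < L \<and> \<bar>a k\<bar> * pattern j > t} \<subseteq> {j. real j + 1 < y k}"
      proof clarify
        fix j assume "t < \<bar>a k\<bar> * pattern j"
        then have "real (max A (j + 1)) < y k"
          unfolding pattern_def y_def using less_mult_powr_iff[of "\<bar>a k\<bar>" t _ P] that t P A by auto
        then show "real j + 1 < y k" by linarith
      qed
      then have "card {j. j < L \<and> \<bar>a k\<bar> * pattern j > t} \<le> card {j. real j + 1 < y k}"
        by (intro card_mono finite_less_real)
      moreover have "real (card {j. real j + 1 < y k}) < y k"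
        using that t by (intro card_less_real) (simp add: y_def)
      ultimately show ?thesis by linarith
    qed
    have card_0: "card {j. j < L \<and> \<bar>a k\<bar> * pattern j > t} = 0" if "a k = 0" for k
      using that t by (simp add: not_less[symmetric])
    \<comment> \<open>One nonzero coefficient makes the total count strictly smaller than
      \<open>i + 1\<close>, hence at most \<open>i\<close>.\<close>
    obtain k where k: "k \<in> {1..n}" "a k \<noteq> 0"
    proof -
      have "\<exists>k\<in>{1..n}. a k \<noteq> 0"
      proof (rule ccontr)
        assume "\<not> ?thesis"
        then have "coef_norm powr P = 0" unfolding coef_norm_powr by (intro sum.neutral) auto
        then show False using False by simp
      qed
      then show thesis using that by blast
    qed
    have "real (\<Sum>k=1..n. card {j. j < L \<and> \<bar>a k\<bar> * pattern j > t}) < (\<Sum>k=1..n. y k)"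
      unfolding of_nat_sum
    proof (rule sum_strict_mono_ex1)
      show "\<forall>k\<in>{1..n}. real (card {j. j < L \<and> \<bar>a k\<bar> * pattern j > t}) \<le> y k"
      proof
        fix k
        show "real (card {j. j < L \<and> \<bar>a k\<bar> * pattern j > t}) \<le> y k"
          using card_less[of k] card_0[of k] by (cases "a k = 0") (auto simp: y_def)
      qed
      show "\<exists>k\<in>{1..n}. real (card {j. j < L \<and> \<bar>a k\<bar> * pattern j > t}) < y k"
        using k(1) card_less[OF k(2)] by (rule bexI[rotated])
    qed simp
    then have "(\<Sum>k=1..n. card {j. j < L \<and> \<bar>a k\<bar> * pattern j > t}) \<le> i"
      unfolding sum_y by linarith
    then show ?thesis using rearr_le_iff[of t i] t unfolding t_def by simp
  qed
qed

text \<open>Each block falls short of its ideal count by at most \<open>A + 1\<close>: rounding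
  costs at most one position, and blocks with ideal count up to \<open>A + 1\<close> are given up.
  Shifting the index by \<open>n * (A + 1)\<close> compensates for this.\<close>

lemma rearr_ge:
  assumes "i + n * (A + 1) < L"
  shows "coef_norm * real (i + n * (A + 1) + 1) powr (- (1 / P)) \<le> rearr i"
proof (cases "coef_norm = 0")
  case True
  then show ?thesis using rearr_nonneg by simp
next
  case False
  define N where "N = i + n * (A + 1) + 1"
  define t where "t = coef_norm * real N powr (- (1 / P))"
  have N: "N > 0" unfolding N_def by simp
  have t: "t > 0" unfolding t_def using False coef_norm_nonneg N by (intro mult_pos_pos) auto
  define y where "y k = (\<bar>a k\<bar> / t) powr P" for k
  have sum_y: "(\<Sum>k=1..n. y k) = real N"
    unfolding y_def t_def using False N by (intro sum_scaled_powr) auto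
  have card_ge: "y k - real (A + 1) \<le> real (card {j. j < L \<and> \<bar>a k\<bar> * pattern j > t})"
    if k: "k \<in> {1..n}" for k
  proof (cases "y k \<le> real (A + 1)")
    case False
    then have ak: "\<bar>a k\<bar> > 0" using P A unfolding y_def by (cases "a k = 0") auto
    have "y k \<le> (\<Sum>k=1..n. y k)" using k by (intro member_le_sum) (auto simp: y_def)
    \<comment> \<open>No single count exceeds \<open>N \<le> L\<close>, so the cut-off at
      \<open>L\<close> removes nothing.\<close>
    then have yL: "y k \<le> real L" using assms unfolding sum_y N_def by linarith
    have "{j. real j + 1 < y k} \<subseteq> {j. j < L \<and> \<bar>a k\<bar> * pattern j > t}"
    proof clarify
      fix j assume j: "real j + 1 < y k"
      then have "real (max A (j + 1)) < y k" using False by auto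
      then have "t < \<bar>a k\<bar> * pattern j"
        unfolding pattern_def using less_mult_powr_iff[of "\<bar>a k\<bar>" t _ P] ak t P A
        by (auto simp: y_def)
      then show "j < L \<and> t < \<bar>a k\<bar> * pattern j" using j yL by linarith
    qed
    then have "card {j. real j + 1 < y k} \<le> card {j. j < L \<and> \<bar>a k\<bar> * pattern j > t}"
      by (intro card_mono) auto
    then show ?thesis using card_less_real_ge[of "y k"] by linarith
  qed auto
  have "real N - real n * real (A + 1) = (\<Sum>k=1..n. y k - real (A + 1))"
    using sum_y by (simp add: sum_subtractf)
  also have "\<dots> \<le> (\<Sum>k=1..n. real (card {j. j < L \<and> \<bar>a k\<bar> * pattern j > t}))"
    using card_ge by (intro sum_mono) auto
  also have "\<dots> = real (\<Sum>k=1..n. card {j. j < L \<and> \<bar>a k\<bar> * pattern j > t})" by simp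
  finally have "real (i + 1) \<le> real (\<Sum>k=1..n. card {j. j < L \<and> \<bar>a k\<bar> * pattern j > t})"
    unfolding N_def by (simp add: algebra_simps)
  then have "\<not> (\<Sum>k=1..n. card {j. j < L \<and> \<bar>a k\<bar> * pattern j > t}) \<le> i" by linarith
  then have "\<not> rearr i \<le> t" using rearr_le_iff[of t i] t by simp
  then show ?thesis unfolding t_def N_def by simp
qed

lemma energy_eq: "energy (lincomb n a (periodic_blocks L pattern)) = (\<Sum>i<n * L. rearr i powr q * v i)"
  unfolding rearr_def by (rule energy_eventually_zero[OF lincomb_periodic_blocks_eq_0])

text \<open>The first \<open>L\<close> terms give \<open>mass\<close>. Beyond them the profile is at
  most \<open>L powr (- q / P)\<close>, and subadditivity bounds the remaining weight by
  \<open>n * W L\<close>.\<close>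

lemma energy_upper:
  "energy (lincomb n a (periodic_blocks L pattern))
    \<le> (mass + real n * (W L * real L powr (- (q / P)))) * coef_norm powr q"
proof -
  have nL: "L \<le> n * L" using n by simp
  have "(\<Sum>i=L..<n * L. profile i * v i) \<le> (\<Sum>i=L..<n * L. real L powr (- (q / P)) * v i)"
    using L by (intro sum_mono mult_right_mono profile_le) auto
  also have "\<dots> = real L powr (- (q / P)) * (W (n * L) - W L)"
    using W_diff[OF nL] by (simp add: sum_distrib_left[symmetric])
  also have "\<dots> \<le> real L powr (- (q / P)) * (real n * W L)"
    using W_mult_le[of n L] W_nonneg[of L] by (intro mult_left_mono) auto
  finally have tail: "(\<Sum>i=L..<n * L. profile i * v i) \<le> real n * (W L * real L powr (- (q / P)))"
    by (simp add: ac_simps)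
  have split: "(\<Sum>i<n * L. profile i * v i) = mass + (\<Sum>i=L..<n * L. profile i * v i)"
    unfolding mass_def using sum.atLeastLessThan_concat[of 0 L "n * L" "\<lambda>i. profile i * v i"] nL
    by (simp add: atLeast0LessThan)
  have "energy (lincomb n a (periodic_blocks L pattern)) \<le> (\<Sum>i<n * L. (coef_norm * pattern i) powr q * v i)"
    unfolding energy_eq using rearr_le rearr_nonneg q by (intro sum_mono mult_right_mono powr_mono2) auto
  also have "\<dots> = (\<Sum>i<n * L. profile i * v i) * coef_norm powr q"
    unfolding profile_eq sum_distrib_right using coef_norm_nonneg pattern_pos
    by (intro sum.cong) (auto simp: powr_mult less_imp_le ac_simps)
  also have "\<dots> \<le> (mass + real n * (W L * real L powr (- (q / P)))) * coef_norm powr q"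
    using split tail by (intro mult_right_mono) auto
  finally show ?thesis .
qed

text \<open>The index shift \<open>R\<close> in the lower bound for the rearrangement costs only the
  first \<open>R\<close> terms of \<open>mass\<close>, and these are controlled by the value at the
  truncation \<open>A\<close>.\<close>

lemma energy_lower:
  "(mass - 2 * real n * (W A * real A powr (- (q / P)))) * coef_norm powr q
    \<le> energy (lincomb n a (periodic_blocks L pattern))"
proof -
  define R where "R = n * (A + 1)"
  have R_split: "mass \<le> (\<Sum>i<R. profile i * v i) + (\<Sum>i<L - R. profile (i + R) * v (i + R))"
  proof (cases "R \<le> L")
    case True
    have "mass = (\<Sum>i<R. profile i * v i) + (\<Sum>i=R..<L. profile i * v i)"
      unfolding mass_def using sum.atLeastLessThan_concat[of 0 R L "\<lambda>i. profile i * v i"] True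
      by (simp add: atLeast0LessThan)
    also have "(\<Sum>i=R..<L. profile i * v i) = (\<Sum>i<L - R. profile (i + R) * v (i + R))"
      using sum.shift_bounds_nat_ivl[of "\<lambda>i. profile i * v i" 0 R "L - R"] True
      by (simp add: atLeast0LessThan)
    finally show ?thesis by simp
  \<comment> \<open>If \<open>R\<close> exceeds \<open>L\<close>, truncated subtraction makes the
    second sum empty and the first one already covers \<open>mass\<close>.\<close>
  next
    case False
    then have "mass \<le> (\<Sum>i<R. profile i * v i)"
      unfolding mass_def by (intro sum_mono2) (auto simp: profile_def)
    with False show ?thesis by simp
  qed
  have "(\<Sum>i<R. profile i * v i) \<le> (\<Sum>i<R. real A powr (- (q / P)) * v i)"
    unfolding profile_def using P q A by (intro sum_mono mult_right_mono powr_mono2') auto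
  also have "\<dots> = real A powr (- (q / P)) * W R" by (simp add: wsum_def sum_distrib_left)
  also have "\<dots> \<le> real A powr (- (q / P)) * (2 * real n * W A)"
  proof (intro mult_left_mono)
    \<comment> \<open>The constant 2 comes from \<open>A + 1 \<le> 2 * A\<close>.\<close>
    have "W R \<le> W ((2 * n) * A)" unfolding R_def using A by (intro W_mono) (simp add: algebra_simps)
    also have "\<dots> \<le> 2 * real n * W A" using W_mult_le[of "2 * n" A] by simp
    finally show "W R \<le> 2 * real n * W A" .
  qed simp
  finally have head: "(\<Sum>i<R. profile i * v i) \<le> 2 * real n * (W A * real A powr (- (q / P)))"
    by (simp add: ac_simps)
  have "(mass - 2 * real n * (W A * real A powr (- (q / P)))) * coef_norm powr q
      \<le> (\<Sum>i<L - R. profile (i + R) * v (i + R)) * coef_norm powr q"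
    using R_split head by (intro mult_right_mono) auto
  also have "\<dots> \<le> (\<Sum>i<L - R. rearr i powr q * v i)"
    unfolding sum_distrib_right
  proof (rule sum_mono)
    fix i assume "i \<in> {..<L - R}"
    then have i: "i + R < L" by auto
    have "profile (i + R) * coef_norm powr q \<le> (real (i + R + 1) powr (- (1 / P))) powr q * coef_norm powr q"
      using profile_le[of "i + R + 1" "i + R"] by (intro mult_right_mono) (auto simp: powr_powr)
    also have "\<dots> = (coef_norm * real (i + R + 1) powr (- (1 / P))) powr q"
      using coef_norm_nonneg by (simp add: powr_mult ac_simps)
    also have "\<dots> \<le> rearr i powr q"
      using rearr_ge[of i] i coef_norm_nonneg q unfolding R_def by (intro powr_mono2) auto
    \<comment> \<open>Moving the weight back from \<open>i + R\<close> to \<open>i\<close> only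
      increases it.\<close>
    finally have "(profile (i + R) * coef_norm powr q) * v (i + R) \<le> rearr i powr q * v i"
      using v_antimono[of i "i + R"] v_pos[of "i + R"] by (intro mult_mono) (auto simp: less_imp_le)
    then show "profile (i + R) * v (i + R) * coef_norm powr q \<le> rearr i powr q * v i" by (simp add: ac_simps)
  qed
  also have "\<dots> \<le> energy (lincomb n a (periodic_blocks L pattern))"
    unfolding energy_eq using n by (intro sum_mono2) (auto intro: order_less_le_trans[of _ "L - R" "n * L"]
      le_trans[of "L - R" L "n * L"])
  finally show ?thesis .
qed

end

end

section \<open>Dyadic choice of the truncations\<close>

context lorentz_weight
begin

text \<open>At \<open>2 ^ l = A\<close> and \<open>2 ^ l = L\<close> this is, up to multiples of
  \<open>n\<close>, the error caused by the respective truncation.\<close>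

definition scaled_W :: "real \<Rightarrow> nat \<Rightarrow> real" where
  "scaled_W \<theta> l = W (2 ^ l) * real (2 ^ l) powr (- \<theta>)"

lemma scaled_W_pos: "scaled_W \<theta> l > 0"
  unfolding scaled_W_def using W_pos[of "2 ^ l"] by simp

lemma scaled_W_Suc: "scaled_W \<theta> l \<le> 2 powr \<theta> * scaled_W \<theta> (Suc l)"
proof -
  have "real (2 ^ l) powr (- \<theta>) = 2 powr \<theta> * real (2 ^ Suc l) powr (- \<theta>)"
    by (simp add: powr_mult powr_minus)
  then show ?thesis
    unfolding scaled_W_def using W_mono[of "2 ^ l" "2 ^ Suc l"]
    by (simp add: mult_right_mono ac_simps)
qed

text \<open>Dyadic summation by parts. On the positions from \<open>2 ^ j\<close> to
  \<open>2 ^ Suc j\<close> the profile is at least its value at the right end, which contributes at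
  least \<open>scaled_W \<theta> (Suc j) - 2 powr (- \<theta>) * scaled_W \<theta> j\<close>. The
  right-hand side is \<open>mass\<close> for dyadic truncations.\<close>

lemma mass_ge_sum_scaled_W:
  assumes "\<theta> \<ge> 0" and "i \<le> j"
  shows "(1 - 2 powr (- \<theta>)) * (\<Sum>l=i..<j. scaled_W \<theta> l) + scaled_W \<theta> j
    \<le> (\<Sum>s<2 ^ j. real (max (2 ^ i) (s + 1)) powr (- \<theta>) * v s)"
  using assms(2)
proof (induction j rule: dec_induct)
  case base
  have "max (2 ^ i) (s + 1) = 2 ^ i" if "s < 2 ^ i" for s :: nat
    using that by simp
  then have "(\<Sum>s<2 ^ i. real (max (2 ^ i) (s + 1)) powr (- \<theta>) * v s)
      = (\<Sum>s<2 ^ i. real (2 ^ i) powr (- \<theta>) * v s)"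
    by (intro sum.cong refl) (simp only: lessThan_iff)
  also have "\<dots> = scaled_W \<theta> i"
    unfolding scaled_W_def wsum_def sum_distrib_left[symmetric] by (rule mult.commute)
  finally show ?case by simp
next
  case (step j)
  let ?g = "\<lambda>s. real (max (2 ^ i) (s + 1)) powr (- \<theta>) * v s"
  have le: "(2::nat) ^ j \<le> 2 ^ Suc j" by simp
  have ij: "(2::nat) ^ i \<le> 2 ^ Suc j" using step.hyps by (intro power_increasing) auto
  have "real (2 ^ Suc j) powr (- \<theta>) * (W (2 ^ Suc j) - W (2 ^ j))
      = (\<Sum>s=2 ^ j..<2 ^ Suc j. real (2 ^ Suc j) powr (- \<theta>) * v s)"
    using W_diff[OF le] by (simp add: sum_distrib_left[symmetric])
  also have "\<dots> \<le> (\<Sum>s=2 ^ j..<2 ^ Suc j. ?g s)"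
  proof (intro sum_mono mult_right_mono powr_mono2')
    fix s assume "s \<in> {2 ^ j..<2 ^ Suc j :: nat}"
    then have "max (2 ^ i) (s + 1) \<le> 2 ^ Suc j" using ij by simp
    then show "real (max (2 ^ i) (s + 1)) \<le> real (2 ^ Suc j)" by (simp only: of_nat_le_iff)
  qed (use assms in auto)
  also have "\<dots> = (\<Sum>s<2 ^ Suc j. ?g s) - (\<Sum>s<2 ^ j. ?g s)"
    using sum.atLeastLessThan_concat[OF _ le, of 0 ?g] by (simp add: atLeast0LessThan del: power_Suc)
  finally have "scaled_W \<theta> (Suc j) - 2 powr (- \<theta>) * scaled_W \<theta> j
      \<le> (\<Sum>s<2 ^ Suc j. ?g s) - (\<Sum>s<2 ^ j. ?g s)"
    unfolding scaled_W_def by (simp add: powr_mult algebra_simps)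
  moreover have "(\<Sum>l=i..<Suc j. scaled_W \<theta> l) = (\<Sum>l=i..<j. scaled_W \<theta> l) + scaled_W \<theta> j"
    using step.hyps by simp
  ultimately show ?case using step.IH by (simp add: algebra_simps del: power_Suc)
qed

lemma dyadic_bracket:
  fixes j :: nat
  assumes "j \<ge> 1"
  obtains i where "2 ^ i \<le> j" and "j < 2 ^ Suc i"
  using ex_power_ivl1[of 2 j] assms by auto

text \<open>The supremum behind \<beta> is nearly attained at some \<open>j\<close>. One factor 2
  pays for near-attainment, another for rounding \<open>j\<close> to a power of two.\<close>

lemma scaled_W_not_decaying:
  assumes "\<theta> \<le> q * lorentz_beta q w"
  shows "\<exists>i. scaled_W \<theta> i \<le> 4 * scaled_W \<theta> (i + N)"
proof -
  define c where "c = (1 / 2 :: real) powr (1 / q)"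
  have c: "0 < c" "c < 1" "c powr q = 1 / 2"
    unfolding c_def using q powr_less_mono2[of "1 / q" "1 / 2" 1] by (auto simp: powr_powr)
  obtain j where j: "j \<ge> 1" "c * 2 powr (real N * lorentz_beta q w) \<le> (W (2 ^ N * j) / W j) powr (1 / q)"
    using upper_dil_attained[OF c(1,2), of N] by auto
  have "(c * 2 powr (real N * lorentz_beta q w)) powr q \<le> ((W (2 ^ N * j) / W j) powr (1 / q)) powr q"
    using j(2) c(1) q by (intro powr_mono2) auto
  then have 1: "1 / 2 * 2 powr (real N * (q * lorentz_beta q w)) \<le> W (2 ^ N * j) / W j"
    using c W_dilation(1)[OF j(1), of N] q by (simp add: powr_mult powr_powr ac_simps)
  have "2 powr (real N * \<theta>) \<le> 2 powr (real N * (q * lorentz_beta q w))"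
    using assms by (intro powr_mono mult_left_mono) auto
  with 1 have "1 / 2 * 2 powr (real N * \<theta>) \<le> W (2 ^ N * j) / W j" by linarith
  then have 2: "2 powr (real N * \<theta>) * W j \<le> 2 * W (2 ^ N * j)"
    using W_pos[OF j(1)] by (simp add: field_simps)
  obtain i where i: "2 ^ i \<le> j" "j < 2 ^ Suc i" using dyadic_bracket[OF j(1)] .
  have "2 powr (real N * \<theta>) * W (2 ^ i) \<le> 2 powr (real N * \<theta>) * W j"
    using i(1) by (intro mult_left_mono W_mono) auto
  also note 2
  also have "W (2 ^ N * j) \<le> W (2 * 2 ^ (i + N))"
    using i(2) by (intro W_mono) (simp add: power_add ac_simps)
  also have "\<dots> \<le> 2 * W (2 ^ (i + N))" using W_mult_le[of 2 "2 ^ (i + N)"] by simp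
  finally have "2 powr (real N * \<theta>) * W (2 ^ i) \<le> 4 * W (2 ^ (i + N))" by simp
  then have "2 powr (real N * \<theta>) * W (2 ^ i) * real (2 ^ (i + N)) powr (- \<theta>)
      \<le> 4 * W (2 ^ (i + N)) * real (2 ^ (i + N)) powr (- \<theta>)" by (rule mult_right_mono) simp
  moreover have "real (2 ^ i) powr (- \<theta>) = 2 powr (real N * \<theta>) * real (2 ^ (i + N)) powr (- \<theta>)"
    by (simp add: powr_realpow[symmetric] powr_powr powr_add[symmetric] algebra_simps)
  then have "scaled_W \<theta> i = 2 powr (real N * \<theta>) * W (2 ^ i) * real (2 ^ (i + N)) powr (- \<theta>)"
    unfolding scaled_W_def by (simp only: ac_simps)
  ultimately have "scaled_W \<theta> i \<le> 4 * scaled_W \<theta> (i + N)"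
    unfolding scaled_W_def[of \<theta> "i + N"] by linarith
  then show ?thesis ..
qed

text \<open>The same argument for \<alpha>; here rounding \<open>j\<close> down to a power of two is
  paid for at the lower scale.\<close>

lemma scaled_W_not_growing:
  assumes "q * lorentz_alpha q w \<le> \<theta>"
  shows "\<exists>i. scaled_W \<theta> (i + N) \<le> 4 * scaled_W \<theta> i"
proof -
  define c where "c = (1 / 2 :: real) powr (1 / q)"
  have c: "0 < c" "c < 1" "c powr q = 1 / 2"
    unfolding c_def using q powr_less_mono2[of "1 / q" "1 / 2" 1] by (auto simp: powr_powr)
  obtain j where j: "j \<ge> 1" "c * 2 powr (real N * (- lorentz_alpha q w)) \<le> (W j / W (2 ^ N * j)) powr (1 / q)"
    using lower_dil_attained[OF c(1,2), of N] by auto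
  have "(c * 2 powr (real N * (- lorentz_alpha q w))) powr q \<le> ((W j / W (2 ^ N * j)) powr (1 / q)) powr q"
    using j(2) c(1) q by (intro powr_mono2) auto
  then have 1: "1 / 2 * 2 powr (real N * - (q * lorentz_alpha q w)) \<le> W j / W (2 ^ N * j)"
    using c W_dilation(3)[OF j(1), of N] W_pos[OF j(1)] q by (simp add: powr_mult powr_powr ac_simps)
  have "2 powr (real N * - \<theta>) \<le> 2 powr (real N * - (q * lorentz_alpha q w))"
    using assms by (intro powr_mono mult_left_mono) auto
  with 1 have "1 / 2 * 2 powr (real N * - \<theta>) \<le> W j / W (2 ^ N * j)" by linarith
  then have 2: "2 powr (real N * - \<theta>) * W (2 ^ N * j) \<le> 2 * W j"
    using W_dilation(3)[OF j(1), of N] by (simp add: field_simps)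
  obtain i where i: "2 ^ i \<le> j" "j < 2 ^ Suc i" using dyadic_bracket[OF j(1)] .
  have "2 powr (real N * - \<theta>) * W (2 ^ (i + N)) \<le> 2 powr (real N * - \<theta>) * W (2 ^ N * j)"
    using i(1) by (intro mult_left_mono W_mono) (auto simp: power_add ac_simps)
  also note 2
  also have "W j \<le> W (2 * 2 ^ i)" using i(2) by (intro W_mono) simp
  also have "\<dots> \<le> 2 * W (2 ^ i)" using W_mult_le[of 2 "2 ^ i"] by simp
  finally have "2 powr (real N * - \<theta>) * W (2 ^ (i + N)) \<le> 4 * W (2 ^ i)" by simp
  then have "2 powr (real N * - \<theta>) * W (2 ^ (i + N)) * real (2 ^ i) powr (- \<theta>)
      \<le> 4 * W (2 ^ i) * real (2 ^ i) powr (- \<theta>)" by (rule mult_right_mono) simp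
  moreover have "real (2 ^ (i + N)) powr (- \<theta>) = 2 powr (real N * - \<theta>) * real (2 ^ i) powr (- \<theta>)"
    by (simp add: powr_realpow[symmetric] powr_powr powr_add[symmetric] algebra_simps)
  then have "scaled_W \<theta> (i + N) = 2 powr (real N * - \<theta>) * W (2 ^ (i + N)) * real (2 ^ i) powr (- \<theta>)"
    unfolding scaled_W_def by (simp only: ac_simps)
  ultimately have "scaled_W \<theta> (i + N) \<le> 4 * scaled_W \<theta> i"
    unfolding scaled_W_def[of \<theta> "i"] by linarith
  then show ?thesis ..
qed

lemma sym_block_fin_rep_finite:
  assumes P: "1 \<le> P" and \<alpha>: "lorentz_alpha q w \<le> 1 / P" and \<beta>: "1 / P \<le> lorentz_beta q w"
  shows "sym_block_fin_rep (ereal P) q w"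
proof (rule sym_block_fin_rep_I)
  fix n :: nat and \<epsilon> :: real assume n: "n \<ge> 1" and \<epsilon>: "\<epsilon> > 0"
  define \<theta> where "\<theta> = q / P"
  have \<theta>: "\<theta> > 0" unfolding \<theta>_def using q P by simp
  have \<theta>\<beta>: "\<theta> \<le> q * lorentz_beta q w" and \<theta>\<alpha>: "q * lorentz_alpha q w \<le> \<theta>"
    using mult_left_mono[OF \<beta>, of q] mult_left_mono[OF \<alpha>, of q] q unfolding \<theta>_def by auto
  define \<gamma> where "\<gamma> = 1 - 2 powr (- \<theta>)"
  have \<gamma>: "0 < \<gamma>" "\<gamma> \<le> 1" unfolding \<gamma>_def using \<theta> powr_less_mono[of "- \<theta>" 0 2] by auto
  \<comment> \<open>One relative error serves both estimates: \<open>1 - \<delta>\<close> is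
    \<open>1 / (1 + \<epsilon>)\<close>, and \<open>\<delta> \<le> \<epsilon>\<close>.\<close>
  define \<delta> where "\<delta> = \<epsilon> / (1 + \<epsilon>)"
  have \<delta>: "0 < \<delta>" "\<delta> \<le> \<epsilon>" "1 - \<delta> = 1 / (1 + \<epsilon>)"
    unfolding \<delta>_def using \<epsilon> by (auto simp: field_simps)
  \<comment> \<open>\<open>2 * n\<close> is the larger multiple of the truncation errors, and
    \<open>\<gamma>\<close> is the fraction of the dyadic sum guaranteed to be in
    \<open>mass\<close>.\<close>
  define K where "K = 2 * real n / (\<delta> * \<gamma>)"
  obtain i j where ij: "i \<le> j"
    and Ki: "K * scaled_W \<theta> i \<le> (\<Sum>l=i..j. scaled_W \<theta> l)"
    and Kj: "K * scaled_W \<theta> j \<le> (\<Sum>l=i..j. scaled_W \<theta> l)"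
    using interval_sum_dominates_ends[of "scaled_W \<theta>" "2 powr \<theta>" 4 K]
      scaled_W_pos scaled_W_Suc scaled_W_not_decaying[OF \<theta>\<beta>] scaled_W_not_growing[OF \<theta>\<alpha>] \<theta>
    by (auto simp: ge_one_powr_ge_zero)
  interpret power_blocks q w P "2 ^ i" "2 ^ j" n
    by unfold_locales (use P n ij in auto)
  have "\<gamma> * (\<Sum>l=i..j. scaled_W \<theta> l) = \<gamma> * (\<Sum>l=i..<j. scaled_W \<theta> l) + \<gamma> * scaled_W \<theta> j"
    using ij by (simp add: sum.last_plus distrib_left add.commute)
  also have "\<dots> \<le> \<gamma> * (\<Sum>l=i..<j. scaled_W \<theta> l) + scaled_W \<theta> j"
    using \<gamma> scaled_W_pos[of \<theta> j] by simp
  also have "\<dots> \<le> mass"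
    using mass_ge_sum_scaled_W[of \<theta> i j] \<theta> ij
    unfolding \<gamma>_def[symmetric] mass_def profile_def \<theta>_def[symmetric] by simp
  finally have mass: "\<gamma> * (\<Sum>l=i..j. scaled_W \<theta> l) \<le> mass" .
  have ends: "2 * real n * scaled_W \<theta> l \<le> \<delta> * mass"
    if "K * scaled_W \<theta> l \<le> (\<Sum>l=i..j. scaled_W \<theta> l)" for l
  proof -
    have "2 * real n * scaled_W \<theta> l = \<delta> * (\<gamma> * (K * scaled_W \<theta> l))"
      unfolding K_def using \<delta> \<gamma> by simp
    also have "\<dots> \<le> \<delta> * (\<gamma> * (\<Sum>l=i..j. scaled_W \<theta> l))"
      using that \<delta> \<gamma> by (intro mult_left_mono) auto
    also have "\<dots> \<le> \<delta> * mass" using mass \<delta> by (intro mult_left_mono) auto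
    finally show ?thesis .
  qed
  have "mass * lp_norm (ereal P) n a powr q / (1 + \<epsilon>)
        \<le> energy (lincomb n a (periodic_blocks (2 ^ j) pattern)) \<and>
      energy (lincomb n a (periodic_blocks (2 ^ j) pattern))
        \<le> (1 + \<epsilon>) * (mass * lp_norm (ereal P) n a powr q)" for a
  proof
    have "mass * lp_norm (ereal P) n a powr q / (1 + \<epsilon>) = (mass * (1 - \<delta>)) * coef_norm a powr q"
      unfolding \<delta>(3) coef_norm_def by simp
    also have "\<dots> \<le> (mass - 2 * real n * (W (2 ^ i) * real (2 ^ i) powr (- (q / P)))) * coef_norm a powr q"
      using ends[OF Ki] unfolding scaled_W_def \<theta>_def
      by (intro mult_right_mono) (auto simp: algebra_simps)
    also note energy_lower[of a]
    finally show "mass * lp_norm (ereal P) n a powr q / (1 + \<epsilon>)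
        \<le> energy (lincomb n a (periodic_blocks (2 ^ j) pattern))" .
    have "real n * scaled_W \<theta> j \<le> 2 * real n * scaled_W \<theta> j"
      using scaled_W_pos[of \<theta> j] by simp
    also note ends[OF Kj]
    also have "\<delta> * mass \<le> \<epsilon> * mass" using \<delta> mass_pos by (intro mult_right_mono) auto
    finally have "real n * scaled_W \<theta> j \<le> \<epsilon> * mass" .
    then have "(mass + real n * (W (2 ^ j) * real (2 ^ j) powr (- (q / P)))) * coef_norm a powr q
        \<le> ((1 + \<epsilon>) * mass) * coef_norm a powr q"
      unfolding scaled_W_def \<theta>_def by (intro mult_right_mono) (auto simp: algebra_simps)
    then show "energy (lincomb n a (periodic_blocks (2 ^ j) pattern))
        \<le> (1 + \<epsilon>) * (mass * lp_norm (ereal P) n a powr q)"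
      using energy_upper[of a] unfolding coef_norm_def by (simp add: mult.assoc)
  qed
  then show "\<exists>L h K. L \<ge> 1 \<and> K > 0 \<and>
      (\<forall>a. K * lp_norm (ereal P) n a powr q / (1 + \<epsilon>) \<le> energy (lincomb n a (periodic_blocks L h)) \<and>
        energy (lincomb n a (periodic_blocks L h)) \<le> (1 + \<epsilon>) * (K * lp_norm (ereal P) n a powr q))"
    using L mass_pos by (intro exI[of _ "2 ^ j"] exI[of _ pattern] exI[of _ mass] conjI allI) auto
qed (use P in simp)

lemma interval_imp_sym_block_fin_rep:
  assumes p: "1 \<le> p" and int: "in_index_interval p (lorentz_alpha q w) (lorentz_beta q w)"
  shows "sym_block_fin_rep p q w"
proof -
  have *: "lorentz_alpha q w \<le> inv_exponent p" "inv_exponent p \<le> lorentz_beta q w"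
    using int in_index_interval_iff[OF p alpha_nonneg beta_nonneg] by auto
  show ?thesis
  proof (cases p)
    case (real P)
    then show ?thesis using sym_block_fin_rep_finite[of P] p * by (simp add: inv_exponent_def)
  next
    case PInf
    then show ?thesis using sym_block_fin_rep_infinity alpha_nonneg * by (simp add: inv_exponent_def)
  qed (use p in auto)
qed

end

section \<open>From blocks to disjoint vectors\<close>

lemma same_ord_dist_refl: "same_ord_dist x x"
  unfolding same_ord_dist_def by (intro exI[of _ id]) auto

text \<open>A bijection of disjoint supports extends to an involution of all indices: exchange
  \<open>S\<close> and \<open>T\<close>, fix everything else.\<close>

lemma same_ord_dist_if_disjoint_supports:
  assumes \<sigma>: "bij_betw \<sigma> S T" and ST: "S \<inter> T = {}"
    and x: "\<And>i. i \<notin> S \<Longrightarrow> x i = 0" and y: "\<And>i. i \<notin> T \<Longrightarrow> y i = 0"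
    and eq: "\<And>i. i \<in> S \<Longrightarrow> y (\<sigma> i) = x i"
  shows "same_ord_dist x y"
proof -
  define \<tau> where "\<tau> = inv_into S \<sigma>"
  have \<tau>: "bij_betw \<tau> T S" unfolding \<tau>_def using \<sigma> by (rule bij_betw_inv_into)
  have \<sigma>\<tau>: "\<sigma> (\<tau> i) = i" if "i \<in> T" for i
    unfolding \<tau>_def using \<sigma> that by (simp add: bij_betw_inv_into_right)
  have \<tau>\<sigma>: "\<tau> (\<sigma> i) = i" if "i \<in> S" for i
    unfolding \<tau>_def using \<sigma> that by (simp add: bij_betw_inv_into_left)
  have mem: "\<sigma> i \<in> T" if "i \<in> S" for i using \<sigma> that by (meson bij_betwE)
  have mem': "\<tau> i \<in> S" if "i \<in> T" for i using \<tau> that by (meson bij_betwE)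
  define \<pi> where "\<pi> i = (if i \<in> S then \<sigma> i else if i \<in> T then \<tau> i else i)" for i
  have "\<pi> (\<pi> i) = i" for i
    unfolding \<pi>_def using mem[of i] mem'[of i] \<sigma>\<tau>[of i] \<tau>\<sigma>[of i] ST by auto
  then have "bij \<pi>" by (intro o_bij[of \<pi> \<pi>]) (auto simp: fun_eq_iff)
  moreover have "y (\<pi> k) = x k" for k
  proof (cases "k \<in> T")
    case True
    then have "k \<notin> S" "\<tau> k \<notin> T" using mem'[of k] ST by auto
    then show ?thesis using True x[of k] y[of "\<tau> k"] by (simp add: \<pi>_def)
  qed (use eq x y in \<open>auto simp: \<pi>_def\<close>)
  ultimately show ?thesis unfolding same_ord_dist_def by blast
qed

text \<open>The permutation of the coefficient lists, conjugated by the two shifts, is a bijection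
  of the intervals carrying the blocks. It runs from block \<open>l\<close> to block
  \<open>k\<close>, which explains the order in the conclusion.\<close>

lemma same_ord_dist_blocks:
  assumes m: "\<forall>k<n. m k < m (Suc k)" and k: "k \<in> {1..n}" and l: "l \<in> {1..n}"
    and same: "same_ord_dist_block (block_coeffs m \<alpha> k) (block_coeffs m \<alpha> l)"
  shows "same_ord_dist (block_vec m \<alpha> l) (block_vec m \<alpha> k)"
proof (cases "k = l")
  case False
  define S where "S k = {m (k - 1)..<m k}" for k
  define len where "len = m k - m (k - 1)"
  obtain \<pi> where \<pi>: "\<pi> permutes {..<len}" and len: "m l - m (l - 1) = len"
    and eq: "\<And>i. i < len \<Longrightarrow> \<alpha> (m (l - 1) + i) = \<alpha> (m (k - 1) + \<pi> i)"
  proof -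
    have lens: "length (block_coeffs m \<alpha> k) = len" "length (block_coeffs m \<alpha> l) = m l - m (l - 1)"
      by (auto simp: block_coeffs_def len_def)
    obtain \<pi> where \<pi>: "\<pi> permutes {..<len}" "m l - m (l - 1) = len"
      "\<forall>i<len. block_coeffs m \<alpha> l ! i = block_coeffs m \<alpha> k ! \<pi> i"
      using same unfolding same_ord_dist_block_def lens by auto
    have "\<alpha> (m (l - 1) + i) = \<alpha> (m (k - 1) + \<pi> i)" if "i < len" for i
    proof -
      have "\<pi> i < len" using permutes_in_image[OF \<pi>(1), of i] that by simp
      then have "block_coeffs m \<alpha> k ! \<pi> i = \<alpha> (m (k - 1) + \<pi> i)"
        unfolding block_coeffs_def len_def by (rule nth_map_upt)
      moreover have "block_coeffs m \<alpha> l ! i = \<alpha> (m (l - 1) + i)"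
        unfolding block_coeffs_def using that \<pi>(2) by (intro nth_map_upt) simp
      ultimately show ?thesis using \<pi>(3) that by simp
    qed
    with that \<pi> show thesis by blast
  qed
  have mm: "m (j - 1) < m j" if "j \<in> {1..n}" for j
    using m that by (metis One_nat_def Suc_diff_1 atLeastAtMost_iff less_le_trans lessI zero_less_one less_eq_Suc_le)
  have bij_shift: "bij_betw (\<lambda>i. m (j - 1) + i) {..<m j - m (j - 1)} (S j)" if "j \<in> {1..n}" for j
    unfolding S_def using mm[OF that]
    by (intro bij_betwI[where g="\<lambda>i. i - m (j - 1)"]) auto
  have "bij_betw ((\<lambda>i. m (k - 1) + i) \<circ> (\<pi> \<circ> the_inv_into {..<len} (\<lambda>i. m (l - 1) + i))) (S l) (S k)"
    using bij_shift[OF k] bij_shift[OF l] permutes_imp_bij[OF \<pi>] unfolding len len_def[symmetric]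
    by (intro bij_betw_trans[of _ _ "{..<len}"] bij_betw_the_inv_into)
  moreover have "the_inv_into {..<len} (\<lambda>i. m (l - 1) + i) i = i - m (l - 1)" if "i \<in> S l" for i
    using that len by (intro the_inv_into_f_eq) (auto simp: S_def inj_on_def)
  ultimately have bij: "bij_betw (\<lambda>i. m (k - 1) + \<pi> (i - m (l - 1))) (S l) (S k)"
    by (simp cong: bij_betw_cong)
  show ?thesis
  proof (rule same_ord_dist_if_disjoint_supports[OF bij])
    have "m k \<le> m (l - 1) \<or> m l \<le> m (k - 1)"
      using mono_upto[OF m, of k "l - 1"] mono_upto[OF m, of l "k - 1"] k l False by force
    then show "S l \<inter> S k = {}" unfolding S_def by auto
    fix i assume i: "i \<in> S l"
    then have less: "i - m (l - 1) < len" using len unfolding S_def by auto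
    have "m (k - 1) + \<pi> (i - m (l - 1)) \<in> S k" using bij i by (meson bij_betwE)
    then show "block_vec m \<alpha> k (m (k - 1) + \<pi> (i - m (l - 1))) = block_vec m \<alpha> l i"
      using i eq[OF less] by (auto simp: block_vec_def S_def)
  qed (auto simp: block_vec_def S_def)
qed (simp add: same_ord_dist_refl)

context lorentz_weight
begin

lemma sym_block_imp_sym_fin_rep:
  assumes "sym_block_fin_rep p q w"
  shows "sym_fin_rep p q w"
  unfolding sym_fin_rep_def
proof (intro allI impI)
  fix n :: nat and \<epsilon> :: real assume "\<epsilon> > 0"
  then obtain m \<alpha> where m: "\<forall>k<n. m k < m (Suc k)"
    and same: "\<forall>k\<in>{1..n}. \<forall>l\<in>{1..n}. same_ord_dist_block (block_coeffs m \<alpha> k) (block_coeffs m \<alpha> l)"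
    and est: "\<forall>a. lp_norm p n a / (1 + \<epsilon>) \<le> lorentz_norm q w (lincomb n a (block_vec m \<alpha>)) \<and>
            lorentz_norm q w (lincomb n a (block_vec m \<alpha>)) \<le> (1 + \<epsilon>) * lp_norm p n a"
    using assms unfolding sym_block_fin_rep_def by blast
  have "block_vec m \<alpha> k \<in> lorentz_space q w" for k
    by (rule eventually_zero_in_lorentz_space[of "m k"]) (simp add: block_vec_def)
  moreover have "same_ord_dist (block_vec m \<alpha> k) (block_vec m \<alpha> l)"
    if "k \<in> {1..n}" "l \<in> {1..n}" for k l
    using same_ord_dist_blocks[OF m that(2,1)] same that by blast
  ultimately show "\<exists>x :: nat \<Rightarrow> nat \<Rightarrow> real.
       (\<forall>k\<in>{1..n}. x k \<in> lorentz_space q w) \<and>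
       (\<forall>k\<in>{1..n}. \<forall>l\<in>{1..n}. k \<noteq> l \<longrightarrow> (\<forall>i. x k i = 0 \<or> x l i = 0)) \<and>
       (\<forall>k\<in>{1..n}. \<forall>l\<in>{1..n}. same_ord_dist (x k) (x l)) \<and>
       (\<forall>a. lp_norm p n a / (1 + \<epsilon>) \<le> lorentz_norm q w (lincomb n a x) \<and>
            lorentz_norm q w (lincomb n a x) \<le> (1 + \<epsilon>) * lp_norm p n a)"
    using block_vec_disjoint[OF m, of \<alpha>] est
    by (intro exI[of _ "block_vec m \<alpha>"]) (simp add: disjointly_supported_def)
qed

end

lemma sym_fin_rep_imp_crude:
  assumes "sym_fin_rep p q w"
  shows "crude_sym_fin_rep p q w"
  unfolding crude_sym_fin_rep_def
\<comment> \<open>The constant \<open>C = 2\<close> is \<open>1 + \<epsilon>\<close> for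
  \<open>\<epsilon> = 1\<close>.\<close>
proof (rule exI[of _ 2], intro conjI allI)
  fix n
  show "\<exists>x :: nat \<Rightarrow> nat \<Rightarrow> real.
       (\<forall>k\<in>{1..n}. x k \<in> lorentz_space q w) \<and>
       (\<forall>k\<in>{1..n}. \<forall>l\<in>{1..n}. k \<noteq> l \<longrightarrow> (\<forall>i. x k i = 0 \<or> x l i = 0)) \<and>
       (\<forall>k\<in>{1..n}. \<forall>l\<in>{1..n}. same_ord_dist (x k) (x l)) \<and>
       (\<forall>a. lp_norm p n a / 2 \<le> lorentz_norm q w (lincomb n a x) \<and>
            lorentz_norm q w (lincomb n a x) \<le> 2 * lp_norm p n a)"
    using assms[unfolded sym_fin_rep_def, rule_format, of 1 n] by simp
qed simp

theorem theorem6p1: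
  fixes q :: real and w :: "nat \<Rightarrow> real" and p :: ereal
  assumes "1 \<le> q"
    and "\<And>k. w k > 0"
    and "\<And>k. w (Suc k) \<le> w k"
    and "1 \<le> p"
  shows "(sym_block_fin_rep p q w \<longleftrightarrow> sym_fin_rep p q w) \<and>
         (sym_fin_rep p q w \<longleftrightarrow> crude_sym_fin_rep p q w) \<and>
         (crude_sym_fin_rep p q w \<longleftrightarrow>
            in_index_interval p (lorentz_alpha q w) (lorentz_beta q w))"
proof -
  interpret lorentz_weight q w
    by unfold_locales (use assms in auto)
  \<comment> \<open>The implications close a cycle: blocks, disjoint vectors, crude representation,
    index interval, blocks.\<close>
  show ?thesis
    using sym_block_imp_sym_fin_rep sym_fin_rep_imp_crude
      crude_sym_fin_rep_imp_interval[OF assms(4)] interval_imp_sym_block_fin_rep[OF assms(4)]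
    by blast
qed

end
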